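(* Let $\mathcal{X}$ be an infinite-dimensional real Banach space. Each $L$-algebra $\mathcal{A}\subset\mathcal{B}(\mathcal{X})$ is contained in a maximal $L$-algebra of the same type; that is, there is an $L$-algebra $\mathcal{B}\subset\mathcal{B}(\mathcal{X})$ of the same type (real, complex or quaternion) as $\mathcal{A}$ such that $\mathcal{A}\subset\mathcal{B}$ and $\mathcal{B}$ is not properly contained in any $L$-algebra on $\mathcal{X}$ of that type.
   Context: $\mathcal{B}(\mathcal{X})$ denotes the algebra of all bounded linear operators on $\mathcal{X}$. An algebra of operators on $\mathcal{X}$ is a (real) subalgebra of $\mathcal{B}(\mathcal{X})$, not assumed unital or closed. It is transitive if it has no non-trivial closed invariant subspaces, equivalently if for any $\varepsilon>0$ and any $x,y\in\mathcal{X}$ with $x\neq 0$ there is $T\in\mathcal{A}$ with $\|Tx-y\|<\varepsilon$. An $L$-algebra is a transitive algebra of operators on $\mathcal{X}$ that contains a non-zero finite rank operator. For an $L$-algebra $\mathcal{A}$, $\mathcal{A}^F$ is the set of all finite rank operators in $\mathcal{A}$, and $\mathcal{X}^F=\mathrm{lin}\{Tx: T\in\mathcal{A}^F, x\in\mathcal{X}\}$ (a dense $\mathcal{A}$-invariant linear subspace). $\mathbb{D}$ is the algebra of all linear operators $\mathcal{X}^F\to\mathcal{X}^F$ (not assumed bounded) commuting with the restrictions to $\mathcal{X}^F$ of all operators in $\mathcal{A}^F$; it is always a finite-dimensional real division algebra, hence isomorphic to $\mathbb{R}$, $\mathbb{C}$ or the quaternions $\mathbb{H}$. $\mathcal{A}$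 is of real, complex or quaternion type if $\mathbb{D}$ is isomorphic to $\mathbb{R}$, $\mathbb{C}$ or $\mathbb{H}$, respectively. *)

theory Defs
  imports "HOL-Analysis.Analysis"
begin

section \<open>The real algebra of quaternions\<close>

datatype quaternion = Quaternion (qre: real) (qi: real) (qj: real) (qk: real)

instantiation quaternion :: real_algebra_1
begin

definition zero_quaternion :: quaternion where "0 = Quaternion 0 0 0 0"

definition one_quaternion :: quaternion where "1 = Quaternion 1 0 0 0"

definition plus_quaternion :: "quaternion \<Rightarrow> quaternion \<Rightarrow> quaternion" where
  "x + y = Quaternion (qre x + qre y) (qi x + qi y) (qj x + qj y) (qk x + qk y)"

definition minus_quaternion :: "quaternion \<Rightarrow> quaternion \<Rightarrow> quaternion" where
  "x - y = Quaternion (qre x - qre y) (qi x - qi y) (qj x - qj y) (qk x - qk y)"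

definition uminus_quaternion :: "quaternion \<Rightarrow> quaternion" where
  "- x = Quaternion (- qre x) (- qi x) (- qj x) (- qk x)"

definition scaleR_quaternion :: "real \<Rightarrow> quaternion \<Rightarrow> quaternion" where
  "scaleR r x = Quaternion (r * qre x) (r * qi x) (r * qj x) (r * qk x)"

definition times_quaternion :: "quaternion \<Rightarrow> quaternion \<Rightarrow> quaternion" where
  "x * y = Quaternion
     (qre x * qre y - qi x * qi y - qj x * qj y - qk x * qk y)
     (qre x * qi y + qi x * qre y + qj x * qk y - qk x * qj y)
     (qre x * qj y - qi x * qk y + qj x * qre y + qk x * qi y)
     (qre x * qk y + qi x * qj y - qj x * qi y + qk x * qre y)"

instance
  by standard
    (simp_all add: zero_quaternion_def one_quaternion_def plus_quaternion_def
      minus_quaternion_def uminus_quaternion_def scaleR_quaternion_def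
      times_quaternion_def algebra_simps)

end

section \<open>L-algebras\<close>

definition finite_dimensional :: "'a::real_vector set \<Rightarrow> bool" where
  "finite_dimensional V \<longleftrightarrow> (\<exists>B. finite B \<and> V \<subseteq> span B)"

definition finite_rank :: "('a::real_normed_vector \<Rightarrow>\<^sub>L 'a) \<Rightarrow> bool" where
  "finite_rank T \<longleftrightarrow> finite_dimensional (range (blinfun_apply T))"

definition operator_algebra :: "('a::real_normed_vector \<Rightarrow>\<^sub>L 'a) set \<Rightarrow> bool" where
  "operator_algebra A \<longleftrightarrow> subspace A \<and> (\<forall>S\<in>A. \<forall>T\<in>A. S o\<^sub>L T \<in> A)"

definition transitive :: "('a::real_normed_vector \<Rightarrow>\<^sub>L 'a) set \<Rightarrow> bool" where
  "transitive A \<longleftrightarrow>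
     (\<forall>M. subspace M \<and> closed M \<and> (\<forall>T\<in>A. blinfun_apply T ` M \<subseteq> M)
        \<longrightarrow> M = {0} \<or> M = UNIV)"

definition L_algebra :: "('a::real_normed_vector \<Rightarrow>\<^sub>L 'a) set \<Rightarrow> bool" where
  "L_algebra A \<longleftrightarrow>
     operator_algebra A \<and> transitive A \<and> (\<exists>T\<in>A. T \<noteq> 0 \<and> finite_rank T)"

definition finite_rank_part ::
  "('a::real_normed_vector \<Rightarrow>\<^sub>L 'a) set \<Rightarrow> ('a \<Rightarrow>\<^sub>L 'a) set" where
  "finite_rank_part A = {T \<in> A. finite_rank T}"

definition finite_rank_space :: "('a::real_normed_vector \<Rightarrow>\<^sub>L 'a) set \<Rightarrow> 'a set" where
  "finite_rank_space A = span {blinfun_apply T x | T x. T \<in> finite_rank_part A}"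

section \<open>The commutant and the type of an L-algebra\<close>

text \<open>A linear operator on the subspace \<open>finite_rank_space A\<close> is represented by the function on the
  whole space that extends it by \<open>0\<close> outside this subspace (so the extension is usually
  not linear on the whole space). Under this representation, sums and scalar multiples are
  pointwise and products are compositions.\<close>

definition commutant :: "('a::real_normed_vector \<Rightarrow>\<^sub>L 'a) set \<Rightarrow> ('a \<Rightarrow> 'a) set" where
  "commutant A = {S.
     S ` finite_rank_space A \<subseteq> finite_rank_space A \<and>
     (\<forall>x. x \<notin> finite_rank_space A \<longrightarrow> S x = 0) \<and>
     (\<forall>x\<in>finite_rank_space A. \<forall>y\<in>finite_rank_space A. S (x + y) = S x + S y) \<and>
     (\<forall>r. \<forall>x\<in>finite_rank_space A. S (r *\<^sub>R x) = r *\<^sub>R S x) \<and>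
     (\<forall>T\<in>finite_rank_part A. \<forall>x\<in>finite_rank_space A.
        S (blinfun_apply T x) = blinfun_apply T (S x))}"

definition real_algebra_iso ::
  "('a::real_vector \<Rightarrow> 'a) set \<Rightarrow> (('a \<Rightarrow> 'a) \<Rightarrow> 'b::real_algebra_1) \<Rightarrow> bool" where
  "real_algebra_iso D \<phi> \<longleftrightarrow>
     bij_betw \<phi> D UNIV \<and>
     (\<forall>S\<in>D. \<forall>T\<in>D. \<phi> (\<lambda>x. S x + T x) = \<phi> S + \<phi> T) \<and>
     (\<forall>r. \<forall>S\<in>D. \<phi> (\<lambda>x. r *\<^sub>R S x) = r *\<^sub>R \<phi> S) \<and>
     (\<forall>S\<in>D. \<forall>T\<in>D. \<phi> (S \<circ> T) = \<phi> S * \<phi> T)"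

datatype algebra_type = Real_Type | Complex_Type | Quaternion_Type

primrec of_type :: "algebra_type \<Rightarrow> ('a::real_normed_vector \<Rightarrow>\<^sub>L 'a) set \<Rightarrow> bool" where
  "of_type Real_Type A \<longleftrightarrow> (\<exists>\<phi> :: _ \<Rightarrow> real. real_algebra_iso (commutant A) \<phi>)"
| "of_type Complex_Type A \<longleftrightarrow> (\<exists>\<phi> :: _ \<Rightarrow> complex. real_algebra_iso (commutant A) \<phi>)"
| "of_type Quaternion_Type A \<longleftrightarrow> (\<exists>\<phi> :: _ \<Rightarrow> quaternion. real_algebra_iso (commutant A) \<phi>)"

end

theory Submission
  imports Defs "HOL-Computational_Algebra.Fundamental_Theorem_Algebra"
begin

text \<open>
  Write \<open>F\<close> for the finite rank operators of an L-algebra \<open>A\<close> and \<open>V\<close> for the span of their ranges.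
  The argument rests on one fact: the orbit of \<^emph>\<open>every\<close> non-zero vector \<open>x\<close> under \<open>F\<close> is exactly
  \<open>V\<close> (lemma \<open>orbit\<close>). By transitivity the orbit of \<open>x\<close> under \<open>A\<close> is dense, and an operator of
  finite rank maps a dense subspace onto its whole range, because finite-dimensional subspaces are
  closed.

  Hence \<open>V\<close> is a simple \<open>F\<close>-module. As in Schur's lemma, an operator commuting with \<open>F\<close> on \<open>V\<close> is
  determined by its value at a single non-zero vector, and the commutant is a division algebra.
  Choosing that vector \<open>x\<close> and \<open>T\<close> in \<open>F\<close> with \<open>T x = x\<close> embeds the commutant into the
  finite-dimensional range of \<open>T\<close> by \<open>S \<mapsto> S x\<close>. So the theorem of Frobenius, proved below from the
  fundamental theorem of algebra, gives every L-algebra a type.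

  If \<open>A \<subseteq> B\<close> are L-algebras, restriction to the space \<open>V\<close> of \<open>A\<close> embeds the commutant of \<open>B\<close> into
  that of \<open>A\<close>. When the types agree the two have the same finite dimension, so that this embedding is
  an isomorphism. In a chain of L-algebras of one type, each operator in the commutant of a member
  therefore has a unique extension to the commutant of every larger member; these extensions glue
  together over the union. So the union has the same type as the members, and Zorn's lemma applies.
\<close>

section \<open>Evaluation of real polynomials and quadratic relations\<close>

text \<open>The algebra has its own unit \<open>e\<close> in the role of the constant polynomial 1. It is a parameter, since
  the algebras of interest consist of endomorphisms of a large space that act only on a subspace;
  their unit is a projection.\<close>

definition algebra_eval :: "'b::real_algebra \<Rightarrow> 'b \<Rightarrow> real poly \<Rightarrow> 'b" where
  "algebra_eval e x p = fold_coeffs (\<lambda>a y. a *\<^sub>R e + x * y) p 0"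

lemma algebra_eval_0 [simp]: "algebra_eval e x 0 = 0"
  by (simp add: algebra_eval_def)

lemma algebra_eval_pCons [simp]:
  "algebra_eval e x (pCons a p) = a *\<^sub>R e + x * algebra_eval e x p"
  by (cases "p = 0 \<and> a = 0") (auto simp: algebra_eval_def)

lemma algebra_eval_add [simp]:
  "algebra_eval e x (p + q) = algebra_eval e x p + algebra_eval e x q"
  by (induction p q rule: poly_induct2) (simp_all add: algebra_simps)

lemma algebra_eval_smult [simp]:
  "algebra_eval e x (smult c p) = c *\<^sub>R algebra_eval e x p"
  by (induction p) (simp_all add: algebra_simps)

lemma algebra_eval_sum:
  "algebra_eval e x (sum f I) = (\<Sum>i\<in>I. algebra_eval e x (f i))"
  by (induction I rule: infinite_finite_induct) simp_all

lemma algebra_eval_mult: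
  assumes "e * e = e" "e * x = x"
  shows "algebra_eval e x (p * q) = algebra_eval e x p * algebra_eval e x q"
proof -
  have unit: "e * algebra_eval e x q = algebra_eval e x q" for q
    by (induction q) (simp_all add: algebra_simps assms flip: mult.assoc)
  show ?thesis
    by (induction p) (simp_all add: algebra_simps unit)
qed

text \<open>A non-real root \<open>z\<close> of a real polynomial comes with its conjugate, so that a real quadratic factor
  splits off; a real root splits off a linear factor.\<close>

lemma real_poly_factor:
  fixes p :: "real poly"
  assumes "degree p > 0"
  obtains q r where "p = q * r" "(\<exists>a. q = [:a, 1:]) \<or> (\<exists>a b. q = [:a, b, 1:])"
proof -
  define P where "P = map_poly complex_of_real p"
  have eval: "poly (map_poly complex_of_real r) z = algebra_eval 1 z r" for r z
    by (induction r) (simp_all add: map_poly_pCons scaleR_conv_of_real)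
  have "degree P > 0"
    using assms by (simp add: P_def degree_map_poly)
  then have "\<not> (\<exists>a l. a \<noteq> 0 \<and> l = 0 \<and> P = pCons a l)"
    by auto
  then obtain z where "poly P z = 0"
    using fundamental_theorem_of_algebra_alt by blast
  then have root: "algebra_eval 1 z p = 0"
    by (simp add: P_def eval)
  \<comment> \<open>the minimal polynomial of \<open>z\<close> over the reals\<close>
  define q :: "real poly" where
    "q = (if Im z = 0 then [:- Re z, 1:] else [:(Re z)\<^sup>2 + (Im z)\<^sup>2, - 2 * Re z, 1:])"
  have q0: "algebra_eval 1 z q = 0"
    by (simp add: q_def complex_eq_iff power2_eq_square algebra_simps)
  define r where "r = p mod q"
  have "p = q * (p div q) + r"
    by (simp add: r_def)
  then have "algebra_eval 1 z p = algebra_eval 1 z q * algebra_eval 1 z (p div q) + algebra_eval 1 z r"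
    by (metis algebra_eval_add algebra_eval_mult mult_1)
  then have r0: "algebra_eval 1 z r = 0"
    using root q0 by simp
  have "r = 0"
  proof (cases "Im z = 0")
    case True
    then have "degree r = 0"
      using degree_mod_less[of q p] by (auto simp: q_def r_def split: if_splits)
    then obtain c where "r = [:c:]"
      by (rule degree_eq_zeroE)
    with r0 show ?thesis
      by simp
  next
    case False
    then have "degree r \<le> 1"
      using degree_mod_less[of q p] by (auto simp: q_def r_def split: if_splits)
    moreover obtain c r' where r': "r = pCons c r'"
      by (cases r)
    ultimately have "degree r' = 0"
      by (cases "r' = 0") auto
    then obtain d where r: "r = [:c, d:]"
      using r' by (metis degree_eq_zeroE)
    have "d * Im z = 0" "c + d * Re z = 0"
      using r0 by (auto simp: r complex_eq_iff algebra_simps)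
    with False show ?thesis
      by (simp add: r)
  qed
  then have "p = q * (p div q)"
    by (simp add: r_def mod_eq_0_iff_dvd)
  moreover have "(\<exists>a. q = [:a, 1:]) \<or> (\<exists>a b. q = [:a, b, 1:])"
    by (simp add: q_def)
  ultimately show thesis
    using that by blast
qed

text \<open>More powers of \<open>x\<close> than the dimension of \<open>D\<close> cannot be independent.\<close>

lemma exists_annihilating_poly:
  fixes D :: "'b::real_algebra set"
  assumes "finite_dimensional D" "e \<in> D" "x \<in> D" "\<And>y. y \<in> D \<Longrightarrow> x * y \<in> D"
  obtains p where "p \<noteq> 0" "algebra_eval e x p = 0"
proof -
  define pw where "pw n = algebra_eval e x (monom 1 n)" for n
  have pw_D: "pw n \<in> D" for n
  proof (induction n)
    case 0
    then show ?case
      using assms by (simp add: pw_def monom_0)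
  next
    case (Suc n)
    then show ?case
      using assms by (simp add: pw_def monom_Suc)
  qed
  obtain B where B: "finite B" "D \<subseteq> span B"
    using assms(1) by (auto simp: finite_dimensional_def)
  define N where "N = card B"
  show thesis
  proof (cases "inj_on pw {..N}")
    case False
    then obtain i j where ij: "i \<noteq> j" "pw i = pw j"
      by (auto simp: inj_on_def)
    have "monom 1 i + smult (- 1) (monom 1 j) \<noteq> (0 :: real poly)"
    proof
      assume "monom 1 i + smult (- 1) (monom 1 j) = (0 :: real poly)"
      then have "coeff (monom 1 i + smult (- 1) (monom 1 j)) i = (0 :: real)"
        by (simp only: coeff_0)
      with ij show False
        by simp
    qed
    moreover have "algebra_eval e x (monom 1 i + smult (- 1) (monom 1 j)) = 0"
      using ij by (simp only: algebra_eval_add algebra_eval_smult flip: pw_def) simp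
    ultimately show thesis
      by (rule that)
  next
    case True
    have "dependent (pw ` {..N})"
    proof (rule ccontr)
      assume "independent (pw ` {..N})"
      then have "card (pw ` {..N}) \<le> N"
        unfolding N_def using B pw_D by (meson image_subset_iff independent_span_bound subset_iff)
      with True show False
        by (simp add: card_image)
    qed
    then obtain u v where u: "v \<in> pw ` {..N}" "u v \<noteq> 0" "(\<Sum>v\<in>pw ` {..N}. u v *\<^sub>R v) = 0"
      by (auto simp: dependent_finite)
    define p where "p = (\<Sum>i\<in>{..N}. smult (u (pw i)) (monom 1 i))"
    have "algebra_eval e x p = (\<Sum>i\<in>{..N}. u (pw i) *\<^sub>R pw i)"
      by (simp add: p_def algebra_eval_sum pw_def del: smult_monom)
    also have "\<dots> = 0"
      using u(3) True by (simp add: sum.reindex)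
    finally have "algebra_eval e x p = 0" .
    moreover obtain i where i: "i \<le> N" "v = pw i"
      using u(1) by auto
    have "coeff p i = u (pw i)"
      using i by (simp add: p_def coeff_sum if_distrib cong: if_cong)
    then have "p \<noteq> 0"
      using u(2) i by auto
    ultimately show thesis
      using that by blast
  qed
qed

definition algebra_iso_onto :: "'b::real_algebra set \<Rightarrow> ('k::real_algebra_1 \<Rightarrow> 'b) \<Rightarrow> bool" where
  "algebra_iso_onto D \<psi> \<longleftrightarrow> linear \<psi> \<and> bij_betw \<psi> UNIV D \<and> (\<forall>x y. \<psi> (x * y) = \<psi> x * \<psi> y)"

text \<open>A linear multiplicative map out of a division algebra is injective as soon as it does not kill 1, so
  injectivity is not among the obligations.\<close>

lemma algebra_iso_ontoI:
  fixes \<psi> :: "'k::real_algebra_1 \<Rightarrow> 'b::real_algebra"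
  assumes lin: "linear \<psi>" and mult: "\<And>x y. \<psi> (x * y) = \<psi> x * \<psi> y"
    and into: "\<And>x. \<psi> x \<in> D" and onto: "\<And>y. y \<in> D \<Longrightarrow> \<exists>x. y = \<psi> x"
    and inverse: "\<And>x :: 'k. x \<noteq> 0 \<Longrightarrow> \<exists>y. x * y = 1" and one: "\<psi> 1 \<noteq> 0"
  shows "algebra_iso_onto D \<psi>"
proof -
  have "x = 0" if "\<psi> x = 0" for x
    by (metis inverse mult mult_zero_left one that)
  then have "inj \<psi>"
    using lin by (simp add: linear_injective_0)
  moreover have "range \<psi> = D"
    using into onto by blast
  ultimately show ?thesis
    using lin mult by (simp add: algebra_iso_onto_def bij_betw_def)
qed

lemma quaternion_right_inverse:
  fixes x :: quaternion
  assumes "x \<noteq> 0"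
  shows "\<exists>y. x * y = 1"
proof -
  define n where "n = (qre x)\<^sup>2 + (qi x)\<^sup>2 + (qj x)\<^sup>2 + (qk x)\<^sup>2"
  \<comment> \<open>the inverse is the conjugate divided by the norm \<open>n\<close>\<close>
  have "n \<noteq> 0"
    using assms by (cases x) (auto simp: n_def zero_quaternion_def sum_power2_eq_zero_iff add_nonneg_eq_0_iff)
  moreover have "x * Quaternion (qre x) (- qi x) (- qj x) (- qk x) = n *\<^sub>R 1"
    by (simp add: times_quaternion_def one_quaternion_def scaleR_quaternion_def n_def power2_eq_square)
  ultimately have "x * ((1 / n) *\<^sub>R Quaternion (qre x) (- qi x) (- qj x) (- qk x)) = 1"
    by simp
  then show ?thesis
    by blast
qed

section \<open>The theorem of Frobenius\<close>

text \<open>A finite-dimensional real division algebra, given as a subset of an algebra whose unit (if it has one)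
  need not be \<open>e\<close>.\<close>

locale division_subalgebra =
  fixes D :: "'b::real_algebra set" and e :: 'b
  assumes subspace_D: "subspace D"
    and mult_closed: "x \<in> D \<Longrightarrow> y \<in> D \<Longrightarrow> x * y \<in> D"
    and unit_in: "e \<in> D" and unit_nonzero: "e \<noteq> 0"
    and unit_left: "x \<in> D \<Longrightarrow> e * x = x" and unit_right: "x \<in> D \<Longrightarrow> x * e = x"
    and left_inverse: "x \<in> D \<Longrightarrow> x \<noteq> 0 \<Longrightarrow> \<exists>y\<in>D. y * x = e"
    and fin_dim: "finite_dimensional D"
begin

lemmas D_closed = subspace_add[OF subspace_D] subspace_diff[OF subspace_D]
  subspace_scale[OF subspace_D] subspace_neg[OF subspace_D] subspace_0[OF subspace_D]
  mult_closed unit_in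

lemma no_zero_divisors:
  assumes "x \<in> D" "y \<in> D" "x * y = 0"
  shows "x = 0 \<or> y = 0"
  by (metis assms left_inverse mult.assoc mult_zero_right unit_left)

text \<open>Take an annihilating polynomial of \<open>x\<close>; since there are no zero divisors, one of its real factors of
  degree one or two annihilates \<open>x\<close> as well.\<close>

lemma quadratic:
  assumes x: "x \<in> D"
  obtains a b where "x * x = a *\<^sub>R x + b *\<^sub>R e"
proof -
  have eval_D: "algebra_eval e x p \<in> D" for p
    by (induction p) (use x in \<open>auto intro: D_closed\<close>)
  have "\<exists>a b. x * x = a *\<^sub>R x + b *\<^sub>R e" if "p \<noteq> 0" "algebra_eval e x p = 0" for p
    using that
  proof (induction "degree p" arbitrary: p rule: less_induct)
    case less
    have "degree p > 0"
    proof (rule ccontr)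
      assume "\<not> degree p > 0"
      then obtain c where "p = [:c:]"
        using degree_eq_zeroE by blast
      with less.prems unit_nonzero show False
        by simp
    qed
    then obtain q r where p: "p = q * r" and q: "(\<exists>a. q = [:a, 1:]) \<or> (\<exists>a b. q = [:a, b, 1:])"
      by (rule real_poly_factor)
    have "algebra_eval e x q * algebra_eval e x r = 0"
      using less.prems by (simp add: p algebra_eval_mult unit_left x unit_in)
    then consider "algebra_eval e x q = 0" | "algebra_eval e x r = 0"
      using no_zero_divisors eval_D by blast
    then show ?case
    proof cases
      case 1
      from q show ?thesis
      proof (elim disjE exE)
        fix a assume "q = [:a, 1:]"
        with 1 have "x = (- a) *\<^sub>R e"
          by (simp add: unit_right x add_eq_0_iff)
        then have "x * x = (- a) *\<^sub>R x + 0 *\<^sub>R e"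
          by (metis add.right_neutral mult_scaleR_right scale_zero_left unit_right x)
        then show ?thesis
          by blast
      next
        fix a b assume "q = [:a, b, 1:]"
        with 1 have "a *\<^sub>R e + (b *\<^sub>R x + x * x) = 0"
          by (simp add: unit_right x distrib_left)
        then have "x * x = (- b) *\<^sub>R x + (- a) *\<^sub>R e"
          by (simp add: add_eq_0_iff2 algebra_simps)
        then show ?thesis
          by blast
      qed
    next
      case 2
      have "r \<noteq> 0"
        using less.prems(1) p by auto
      moreover have "degree q > 0"
        using q by auto
      ultimately have "degree r < degree p"
        using less.prems(1) p by (auto simp: degree_mult_eq)
      then show ?thesis
        using less.hyps 2 \<open>r \<noteq> 0\<close> by blast
    qed
  qed
  then show thesis
    using that exists_annihilating_poly[OF fin_dim unit_in x] mult_closed x by metis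
qed

text \<open>As in the quaternions, the imaginary elements are those whose square is a non-positive real. That
  they form a subspace is the heart of the classification.\<close>

definition imaginary :: "'b set" where
  "imaginary = {x \<in> D. \<exists>c\<ge>0. x * x = - (c *\<^sub>R e)}"

lemma imaginary_D: "x \<in> imaginary \<Longrightarrow> x \<in> D"
  by (simp add: imaginary_def)

text \<open>A positive \<open>d\<close> has a real square root, and \<open>y\<^sup>2 - d\<close> then factors.\<close>

lemma square_eq_real:
  assumes "y \<in> D" "y * y = d *\<^sub>R e"
  shows "y \<in> imaginary \<or> (\<exists>s. y = s *\<^sub>R e)"
proof (cases "d \<le> 0")
  case True
  then have "y \<in> imaginary"
    using assms by (auto simp: imaginary_def intro!: exI[of _ "- d"])
  then show ?thesis ..
next
  case False
  have "(y - sqrt d *\<^sub>R e) * (y + sqrt d *\<^sub>R e) = 0"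
    using False assms by (simp add: algebra_simps unit_left unit_right unit_in)
  then have "y - sqrt d *\<^sub>R e = 0 \<or> y + sqrt d *\<^sub>R e = 0"
    using assms by (intro no_zero_divisors D_closed)
  then have "y = sqrt d *\<^sub>R e \<or> y = (- sqrt d) *\<^sub>R e"
    by (auto simp: add_eq_0_iff2)
  then show ?thesis
    by blast
qed

text \<open>Completing the square in the quadratic relation of \<open>x\<close> leaves an element with real square.\<close>

lemma real_plus_imaginary:
  assumes x: "x \<in> D"
  obtains a v where "x = a *\<^sub>R e + v" "v \<in> imaginary"
proof -
  obtain a b where ab: "x * x = a *\<^sub>R x + b *\<^sub>R e"
    using quadratic x .
  define y where "y = x - (a / 2) *\<^sub>R e"
  have yD: "y \<in> D"
    by (auto simp: y_def intro: D_closed x)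
  have "y * y = (b + a\<^sup>2 / 4) *\<^sub>R e"
    by (simp add: y_def algebra_simps unit_left unit_right unit_in x ab power2_eq_square
        flip: scaleR_add_left)
  with yD consider "y \<in> imaginary" | s where "y = s *\<^sub>R e"
    using square_eq_real by blast
  then show thesis
  proof cases
    case 1
    then show ?thesis
      using that[of "a / 2" y] by (simp add: y_def)
  next
    case 2
    have "0 \<in> imaginary"
      by (auto simp: imaginary_def intro: D_closed intro!: exI[of _ 0])
    moreover have "x = (s + a / 2) *\<^sub>R e + 0"
      using 2 by (simp add: y_def algebra_simps)
    ultimately show ?thesis
      using that by blast
  qed
qed

lemma imaginary_scale: "x \<in> imaginary \<Longrightarrow> t *\<^sub>R x \<in> imaginary"
  by (auto simp: imaginary_def intro: D_closed) (metis mult_nonneg_nonneg scaleR_scaleR zero_le_square)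

lemma real_imaginary_zero:
  assumes "s *\<^sub>R e \<in> imaginary"
  shows "s = 0"
proof -
  obtain c where c: "c \<ge> 0" "(s *\<^sub>R e) * (s *\<^sub>R e) = - (c *\<^sub>R e)"
    using assms by (auto simp: imaginary_def)
  then have "(s * s + c) *\<^sub>R e = 0"
    by (simp add: algebra_simps unit_left unit_in)
  then have "s * s + c = 0"
    using unit_nonzero by simp
  then show ?thesis
    using c(1) by (smt (verit) mult_eq_0_iff zero_le_square)
qed

text \<open>Solving the relation for \<open>y\<close> and squaring gives a real value only if the mixed term vanishes, and
  that is impossible unless \<open>y\<close> is real or a multiple of \<open>x\<close>.\<close>

lemma imaginary_independent:
  assumes x: "x \<in> imaginary" and y: "y \<in> imaginary" and "x \<noteq> 0" "\<And>t. y \<noteq> t *\<^sub>R x"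
    and rel: "\<alpha> *\<^sub>R x + \<beta> *\<^sub>R y = \<gamma> *\<^sub>R e"
  shows "\<alpha> = 0 \<and> \<beta> = 0"
proof -
  have nr: "s *\<^sub>R x \<noteq> g *\<^sub>R e" if "s \<noteq> 0" for s g
  proof
    assume *: "s *\<^sub>R x = g *\<^sub>R e"
    then have "g = 0"
      using imaginary_scale[OF x, of s] real_imaginary_zero by simp
    with * that \<open>x \<noteq> 0\<close> show False
      by simp
  qed
  have "\<beta> = 0"
  proof (rule ccontr)
    assume "\<beta> \<noteq> 0"
    define t where "t = - \<alpha> / \<beta>"
    define g where "g = \<gamma> / \<beta>"
    have "\<beta> *\<^sub>R y = \<gamma> *\<^sub>R e - \<alpha> *\<^sub>R x"
      using rel by (simp add: algebra_simps)
    then have "(1 / \<beta>) *\<^sub>R (\<beta> *\<^sub>R y) = (1 / \<beta>) *\<^sub>R (\<gamma> *\<^sub>R e - \<alpha> *\<^sub>R x)"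
      by simp
    then have y_eq: "y = t *\<^sub>R x + g *\<^sub>R e"
      using \<open>\<beta> \<noteq> 0\<close> by (simp add: t_def g_def algebra_simps)
    obtain c d where "x * x = - (c *\<^sub>R e)" "y * y = - (d *\<^sub>R e)"
      using x y by (auto simp: imaginary_def)
    then have "(2 * t * g) *\<^sub>R x = (t * t * c - g * g - d) *\<^sub>R e"
      using imaginary_D[OF x]
      by (simp add: y_eq algebra_simps unit_left unit_right unit_in)
        (simp add: algebra_simps mult_2 flip: scaleR_add_left scaleR_2)
    then have "2 * t * g = 0"
      using nr by blast
    then consider "g = 0" | "t = 0"
      by auto
    then show False
    proof cases
      case 1
      then show ?thesis
        using y_eq assms(4)[of t] by simp
    next
      case 2
      then have "g = 0"
        using y_eq y real_imaginary_zero by simp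
      then show ?thesis
        using 2 y_eq assms(4)[of 0] by simp
    qed
  qed
  with rel nr show ?thesis
    by auto
qed

text \<open>Both \<open>x + y\<close> and \<open>x - y\<close> satisfy quadratic relations. Their squares add up to the real number
  \<open>2 x\<^sup>2 + 2 y\<^sup>2\<close>, so by independence the linear coefficients vanish and \<open>(x + y)\<^sup>2\<close> is real.\<close>

lemma imaginary_add:
  assumes x: "x \<in> imaginary" and y: "y \<in> imaginary"
  shows "x + y \<in> imaginary"
proof (cases "x = 0 \<or> (\<exists>t. y = t *\<^sub>R x)")
  case True
  then show ?thesis
    using y imaginary_scale[OF x, of "1 + _"] by (auto simp: algebra_simps)
next
  case False
  note ind = imaginary_independent[OF x y]
  have D: "x + y \<in> D" "x - y \<in> D"
    using x y by (auto intro: D_closed imaginary_D)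
  obtain c d where sq: "x * x = - (c *\<^sub>R e)" "y * y = - (d *\<^sub>R e)"
    using x y by (auto simp: imaginary_def)
  obtain p q where pq: "(x + y) * (x + y) = p *\<^sub>R (x + y) + q *\<^sub>R e"
    using quadratic D(1) .
  obtain r s where rs: "(x - y) * (x - y) = r *\<^sub>R (x - y) + s *\<^sub>R e"
    using quadratic D(2) .
  have "(x + y) * (x + y) + (x - y) * (x - y) = - ((2 * (c + d)) *\<^sub>R e)"
    by (simp add: algebra_simps sq mult_2 scaleR_2 flip: scaleR_add_left)
  then have "(p + r) *\<^sub>R x + (p - r) *\<^sub>R y = (- 2 * (c + d) - q - s) *\<^sub>R e"
    unfolding pq rs by (simp add: algebra_simps)
  then have "p = 0"
    using ind False by fastforce
  then consider "x + y \<in> imaginary" | s where "x + y = s *\<^sub>R e"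
    using square_eq_real[OF D(1)] pq by auto
  then show ?thesis
  proof cases
    case 2
    then have "1 *\<^sub>R x + 1 *\<^sub>R y = s *\<^sub>R e"
      by simp
    then show ?thesis
      using ind False by (metis zero_neq_one)
  qed
qed

text \<open>Polarisation of the quadratic form \<open>x \<mapsto> x\<^sup>2\<close>, which is real on the imaginary elements: the
  anticommutator is the associated bilinear form and serves as an inner product.\<close>

lemma imaginary_anticommutator:
  assumes x: "x \<in> imaginary" and y: "y \<in> imaginary"
  obtains a where "x * y + y * x = a *\<^sub>R e"
proof -
  obtain c d b where "x * x = - (c *\<^sub>R e)" "y * y = - (d *\<^sub>R e)" "(x + y) * (x + y) = - (b *\<^sub>R e)"
    using x y imaginary_add[OF x y] by (auto simp: imaginary_def)
  then have "x * y + y * x = (c + d - b) *\<^sub>R e"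
    by (simp add: algebra_simps)
  then show thesis
    using that by blast
qed

lemma normalise_imaginary:
  assumes "x \<in> imaginary" "x \<noteq> 0"
  obtains t where "t > 0" "t *\<^sub>R x \<in> imaginary" "(t *\<^sub>R x) * (t *\<^sub>R x) = - e"
proof -
  obtain c where c: "c \<ge> 0" "x * x = - (c *\<^sub>R e)"
    using assms by (auto simp: imaginary_def)
  have "c \<noteq> 0"
    using c(2) no_zero_divisors[of x x] assms imaginary_D by auto
  then have "(1 / sqrt c) * ((1 / sqrt c) * c) = 1"
    using c(1) by (simp add: field_simps)
  then have "((1 / sqrt c) *\<^sub>R x) * ((1 / sqrt c) *\<^sub>R x) = - e"
    by (simp add: c(2))
  then show thesis
    using that[of "1 / sqrt c"] c(1) \<open>c \<noteq> 0\<close> imaginary_scale[OF assms(1)] by auto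
qed

lemma complex_units:
  assumes i: "i \<in> D" "i * i = - e"
    and span: "\<And>v. v \<in> imaginary \<Longrightarrow> \<exists>b. v = b *\<^sub>R i"
  shows "algebra_iso_onto D (\<lambda>z. Re z *\<^sub>R e + Im z *\<^sub>R i)"
proof (rule algebra_iso_ontoI)
  show "\<exists>z. x = Re z *\<^sub>R e + Im z *\<^sub>R i" if x: "x \<in> D" for x
  proof -
    obtain a v where "x = a *\<^sub>R e + v" "v \<in> imaginary"
      using real_plus_imaginary x .
    then show ?thesis
      using span by (metis complex.sel)
  qed
  show "\<exists>w. z * w = 1" if "z \<noteq> 0" for z :: complex
    using that by (intro exI[of _ "inverse z"]) simp
qed (auto simp: linear_iff algebra_simps unit_left unit_right unit_in unit_nonzero i
    intro: D_closed i)

lemma quaternion_units: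
  assumes i: "i \<in> D" "i * i = - e" and j: "j \<in> D" "j * j = - e" and ij: "j * i = - (i * j)"
    and span: "\<And>v. v \<in> imaginary \<Longrightarrow> \<exists>a b c. v = a *\<^sub>R i + b *\<^sub>R j + c *\<^sub>R (i * j)"
  shows "algebra_iso_onto D (\<lambda>q. qre q *\<^sub>R e + qi q *\<^sub>R i + qj q *\<^sub>R j + qk q *\<^sub>R (i * j))"
proof (rule algebra_iso_ontoI)
  define k where "k = i * j"
  have k: "k \<in> D"
    by (simp add: k_def D_closed i j)
  have table: "i * j = k" "j * i = - k" "i * k = - j" "k * i = j" "j * k = i" "k * j = - i" "k * k = - e"
  proof -
    show "i * j = k" "j * i = - k"
      by (simp_all add: k_def ij)
    show ik: "i * k = - j"
      by (simp add: k_def i unit_left j flip: mult.assoc)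
    show kj: "k * j = - i"
      by (simp add: k_def j unit_right i mult.assoc)
    show ki: "k * i = j"
      by (metis \<open>j * i = - k\<close> ik k_def minus_equation_iff mult.assoc mult_minus_right)
    show jk: "j * k = i"
      by (metis \<open>j * i = - k\<close> kj k_def minus_equation_iff mult.assoc mult_minus_left)
    show "k * k = - e"
      by (metis ki j(2) k_def mult.assoc)
  qed
  show "\<exists>q. x = qre q *\<^sub>R e + qi q *\<^sub>R i + qj q *\<^sub>R j + qk q *\<^sub>R (i * j)" if x: "x \<in> D" for x
  proof -
    obtain a v where "x = a *\<^sub>R e + v" "v \<in> imaginary"
      using real_plus_imaginary x .
    moreover obtain b c d where "v = b *\<^sub>R i + c *\<^sub>R j + d *\<^sub>R (i * j)"
      using span calculation by blast
    ultimately show ?thesis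
      by (intro exI[of _ "Quaternion a b c d"]) (simp add: algebra_simps)
  qed
  show "\<exists>y. x * y = 1" if "x \<noteq> 0" for x :: quaternion
    using quaternion_right_inverse that .
  show "qre (x * y) *\<^sub>R e + qi (x * y) *\<^sub>R i + qj (x * y) *\<^sub>R j + qk (x * y) *\<^sub>R (i * j) =
    (qre x *\<^sub>R e + qi x *\<^sub>R i + qj x *\<^sub>R j + qk x *\<^sub>R (i * j)) *
    (qre y *\<^sub>R e + qi y *\<^sub>R i + qj y *\<^sub>R j + qk y *\<^sub>R (i * j))" for x y
    by (simp add: table times_quaternion_def algebra_simps unit_left unit_right unit_in i j k)
  show "qre x *\<^sub>R e + qi x *\<^sub>R i + qj x *\<^sub>R j + qk x *\<^sub>R (i * j) \<in> D" for x
    by (intro D_closed i j)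
qed (simp_all add: linear_iff algebra_simps plus_quaternion_def scaleR_quaternion_def
    one_quaternion_def unit_nonzero)

text \<open>The three cases are imaginary part zero, one-dimensional, and larger. In the last one a Gram-Schmidt
  step produces anticommuting \<open>i\<close>, \<open>j\<close> with square \<open>- e\<close>. There is no room for more than \<open>i\<close>, \<open>j\<close> and
  \<open>k = i j\<close>: an imaginary \<open>l\<close> orthogonal to all three anticommutes with \<open>i\<close> and \<open>j\<close>, hence commutes
  with \<open>k\<close>; but it also anticommutes with \<open>k\<close>, so that \<open>k l = 0\<close>.\<close>

theorem frobenius:
  "(\<exists>\<psi> :: real \<Rightarrow> 'b. algebra_iso_onto D \<psi>) \<or>
   (\<exists>\<psi> :: complex \<Rightarrow> 'b. algebra_iso_onto D \<psi>) \<or>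
   (\<exists>\<psi> :: quaternion \<Rightarrow> 'b. algebra_iso_onto D \<psi>)"
proof (cases "imaginary \<subseteq> {0}")
  case True
  have "algebra_iso_onto D (\<lambda>a :: real. a *\<^sub>R e)"
  proof (rule algebra_iso_ontoI)
    show "\<exists>a. x = a *\<^sub>R e" if x: "x \<in> D" for x
      using real_plus_imaginary[OF x] True by (metis add.right_neutral singletonD subsetD)
    show "\<exists>b. a * b = 1" if "a \<noteq> 0" for a :: real
      using that by (intro exI[of _ "inverse a"]) simp
  qed (auto simp: linear_iff algebra_simps unit_left unit_in unit_nonzero intro: D_closed)
  then show ?thesis
    by blast
next
  case False
  then obtain u where "u \<in> imaginary" "u \<noteq> 0"
    by blast
  then obtain i where i: "i \<in> imaginary" "i * i = - e"
    using normalise_imaginary by metis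
  note iD = imaginary_D[OF i(1)]
  show ?thesis
  proof (cases "\<forall>v\<in>imaginary. \<exists>b. v = b *\<^sub>R i")
    case True
    then show ?thesis
      using complex_units[OF iD i(2)] by blast
  next
    case False
    then obtain v where v: "v \<in> imaginary" "\<And>b. v \<noteq> b *\<^sub>R i"
      by blast
    obtain a where a: "i * v + v * i = a *\<^sub>R e"
      using imaginary_anticommutator i(1) v(1) .
    \<comment> \<open>the component of \<open>v\<close> orthogonal to \<open>i\<close>\<close>
    define w where "w = v + (a / 2) *\<^sub>R i"
    have "w \<in> imaginary"
      by (simp add: w_def imaginary_add imaginary_scale i(1) v(1))
    moreover have "w \<noteq> 0"
      using v(2)[of "- (a / 2)"] by (auto simp: w_def add_eq_0_iff2)
    moreover have wi: "w * i = - (i * w)"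
      using a by (simp add: w_def algebra_simps i(2) flip: scaleR_add_left)
    ultimately obtain j t where j: "j \<in> imaginary" "j * j = - e" and "j = t *\<^sub>R w"
      using normalise_imaginary by metis
    then have ji: "j * i = - (i * j)"
      using wi by simp
    note jD = imaginary_D[OF j(1)]
    define k where "k = i * j"
    have kD: "k \<in> D"
      by (simp add: k_def D_closed iD jD)
    have kk: "k * k = - e"
    proof -
      have "k * k = i * (j * i) * j"
        by (simp add: k_def mult.assoc)
      also have "\<dots> = - ((i * i) * (j * j))"
        by (simp add: ji mult.assoc)
      finally show ?thesis
        by (simp add: i(2) j(2) unit_left unit_in)
    qed
    then have k: "k \<in> imaginary"
      using kD by (auto simp: imaginary_def intro!: exI[of _ 1])
    have "\<exists>a b c. v = a *\<^sub>R i + b *\<^sub>R j + c *\<^sub>R (i * j)" if v: "v \<in> imaginary" for v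
    proof -
      obtain a b c
        where abc: "i * v + v * i = a *\<^sub>R e" "j * v + v * j = b *\<^sub>R e" "k * v + v * k = c *\<^sub>R e"
        using imaginary_anticommutator v i(1) j(1) k by metis
      \<comment> \<open>the component of \<open>v\<close> orthogonal to \<open>i\<close>, \<open>j\<close> and \<open>k\<close>\<close>
      define l where "l = v + (a / 2) *\<^sub>R i + (b / 2) *\<^sub>R j + (c / 2) *\<^sub>R k"
      have ik: "i * k + k * i = 0"
        by (simp add: k_def mult.assoc ji)
      have "j * k = (j * i) * j"
        by (simp add: k_def mult.assoc)
      then have jk: "j * k + k * j = 0"
        by (simp add: ji k_def)
      have li: "l * i = - (i * l)"
      proof -
        have "l * i + i * l = (i * v + v * i) + a *\<^sub>R (i * i) +
          (b / 2) *\<^sub>R (j * i + i * j) + (c / 2) *\<^sub>R (i * k + k * i)"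
          by (simp add: l_def algebra_simps flip: scaleR_add_left)
        then show ?thesis
          by (simp add: abc ji ik i(2) add_eq_0_iff2)
      qed
      have lj: "l * j = - (j * l)"
      proof -
        have "l * j + j * l = (j * v + v * j) + b *\<^sub>R (j * j) +
          (a / 2) *\<^sub>R (j * i + i * j) + (c / 2) *\<^sub>R (j * k + k * j)"
          by (simp add: l_def algebra_simps flip: scaleR_add_left)
        then show ?thesis
          by (simp add: abc ji jk j(2) add_eq_0_iff2)
      qed
      have lk: "l * k = - (k * l)"
      proof -
        have "l * k + k * l = (k * v + v * k) + c *\<^sub>R (k * k) +
          (a / 2) *\<^sub>R (i * k + k * i) + (b / 2) *\<^sub>R (j * k + k * j)"
          by (simp add: l_def algebra_simps flip: scaleR_add_left)
        then show ?thesis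
          by (simp add: abc ik jk kk add_eq_0_iff2)
      qed
      have "l * k = (l * i) * j"
        by (simp add: k_def mult.assoc)
      also have "\<dots> = - (i * (l * j))"
        by (simp add: li mult.assoc)
      also have "\<dots> = k * l"
        by (simp add: lj k_def mult.assoc)
      finally have "k * l = - (k * l)"
        using lk by simp
      then have "k * l = 0"
        by (metis add.right_inverse real_vector_eq_affinity scaleR_2 scaleR_eq_0_iff zero_neq_numeral)
      moreover have "k \<noteq> 0"
        using kk unit_nonzero by auto
      moreover have "l \<in> D"
        unfolding l_def by (intro D_closed imaginary_D v i(1) j(1) k)
      ultimately have "l = 0"
        using no_zero_divisors kD by blast
      then have "v = (- (a / 2)) *\<^sub>R i + (- (b / 2)) *\<^sub>R j + (- (c / 2)) *\<^sub>R (i * j)"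
        by (simp add: l_def k_def algebra_simps add_eq_0_iff2)
      then show ?thesis
        by blast
    qed
    then show ?thesis
      using quaternion_units[OF iD i(2) jD j(2) ji] by blast
  qed
qed

end

section \<open>Finite-dimensional subspaces and finite rank operators\<close>

lemma finite_dimensional_mono: "finite_dimensional W \<Longrightarrow> V \<subseteq> W \<Longrightarrow> finite_dimensional V"
  unfolding finite_dimensional_def by blast

lemma finite_dimensional_linear_image:
  assumes "linear f" "finite_dimensional V"
  shows "finite_dimensional (f ` V)"
proof -
  obtain B where "finite B" "V \<subseteq> span B"
    using assms(2) by (auto simp: finite_dimensional_def)
  then have "finite (f ` B)" "f ` V \<subseteq> span (f ` B)"
    using assms(1) by (auto simp: linear_span_image)
  then show ?thesis
    unfolding finite_dimensional_def by blast
qed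

lemma finite_dimensional_linear_inj:
  assumes lin: "linear f" and inj: "inj_on f D" and D: "subspace D" and fin: "finite_dimensional (f ` D)"
  shows "finite_dimensional D"
proof -
  obtain B where B: "B \<subseteq> D" "independent B" "D \<subseteq> span B"
    using maximal_independent_subset by blast
  have "span B = D"
    using B D by (metis span_minimal subset_antisym)
  then have "independent (f ` B)"
    using linear_independent_injective_image[OF lin B(2)] inj by simp
  moreover obtain C where "finite C" "f ` D \<subseteq> span C"
    using fin by (auto simp: finite_dimensional_def)
  ultimately have "finite (f ` B)"
    using B(1) by (meson image_mono independent_span_bound order_trans)
  then have "finite B"
    using B(1) inj by (meson finite_image_iff inj_on_subset)
  then show ?thesis
    using B by (auto simp: finite_dimensional_def)
qed

text \<open>If \<open>x\<close> has positive distance \<open>d\<close> from the closed subspace, the coefficient of \<open>x\<close> is a Lipschitz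
  function of the vector, with constant \<open>1 / d\<close>. In a convergent sequence the coefficients therefore
  converge, and so do the remaining components.\<close>

lemma closed_span_insert:
  fixes x :: "'a::real_normed_vector"
  assumes "closed (span B)"
  shows "closed (span (insert x B))"
proof (cases "x \<in> span B")
  case True
  then show ?thesis
    using assms by (simp add: span_redundant)
next
  case False
  define d where "d = infdist x (span B)"
  have "span B \<noteq> {}"
    using span_0 by blast
  then have "d \<noteq> 0"
    using False in_closed_iff_infdist_zero[OF assms] by (simp add: d_def)
  then have "d > 0"
    using infdist_nonneg[of x "span B"] by (simp add: d_def)
  have coeff_bound: "\<bar>c\<bar> * d \<le> norm y" if y: "y - c *\<^sub>R x \<in> span B" for y c
  proof (cases "c = 0")
    case False
    have "(- (1 / c)) *\<^sub>R (y - c *\<^sub>R x) \<in> span B"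
      using y by (rule span_scale)
    moreover have "(- (1 / c)) *\<^sub>R (y - c *\<^sub>R x) = x - (1 / c) *\<^sub>R y"
      using False by (simp add: algebra_simps)
    ultimately have "x - (1 / c) *\<^sub>R y \<in> span B"
      by simp
    then have "d \<le> dist x (x - (1 / c) *\<^sub>R y)"
      unfolding d_def by (rule infdist_le)
    also have "\<dots> = norm y / \<bar>c\<bar>"
      by (simp add: dist_norm)
    finally show ?thesis
      using False by (simp add: field_simps)
  qed simp
  show ?thesis
  proof (unfold closed_sequential_limits, intro allI impI, elim conjE)
    fix z l
    assume "\<forall>n. z n \<in> span (insert x B)" and lim: "z \<longlonglongrightarrow> l"
    then have "\<forall>n. \<exists>c. z n - c *\<^sub>R x \<in> span B"
      by (simp add: span_breakdown_eq)
    then obtain c where c: "\<And>n. z n - c n *\<^sub>R x \<in> span B"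
      by metis
    have "Cauchy c"
    proof (rule metric_CauchyI)
      fix r :: real
      assume "r > 0"
      then obtain M where M: "\<And>m n. m \<ge> M \<Longrightarrow> n \<ge> M \<Longrightarrow> dist (z m) (z n) < r * d"
        using metric_CauchyD[OF LIMSEQ_imp_Cauchy[OF lim], of "r * d"] \<open>d > 0\<close> by auto
      have "dist (c m) (c n) < r" if "m \<ge> M" "n \<ge> M" for m n
      proof -
        have "(z m - z n) - (c m - c n) *\<^sub>R x \<in> span B"
          using span_diff[OF c[of m] c[of n]] by (simp add: algebra_simps)
        then have "\<bar>c m - c n\<bar> * d \<le> dist (z m) (z n)"
          unfolding dist_norm by (rule coeff_bound)
        also have "\<dots> < r * d"
          by (rule M[OF that])
        finally have "\<bar>c m - c n\<bar> * d < r * d" .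
        then show ?thesis
          using \<open>d > 0\<close> by (simp add: dist_real_def)
      qed
      then show "\<exists>M. \<forall>m\<ge>M. \<forall>n\<ge>M. dist (c m) (c n) < r"
        by blast
    qed
    then obtain k where "c \<longlonglongrightarrow> k"
      using Cauchy_convergent convergent_def by blast
    then have "(\<lambda>n. z n - c n *\<^sub>R x) \<longlonglongrightarrow> l - k *\<^sub>R x"
      using lim by (intro tendsto_intros)
    then have "l - k *\<^sub>R x \<in> span B"
      by (rule closed_sequentially[OF assms c])
    then show "l \<in> span (insert x B)"
      by (auto simp: span_breakdown_eq)
  qed
qed

lemma closed_finite_dimensional:
  fixes W :: "'a::real_normed_vector set"
  assumes "subspace W" "finite_dimensional W"
  shows "closed W"
proof -
  obtain B where B: "B \<subseteq> W" "independent B" "W \<subseteq> span B"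
    using maximal_independent_subset by blast
  obtain C where "finite C" "W \<subseteq> span C"
    using assms(2) by (auto simp: finite_dimensional_def)
  then have "finite B"
    using B by (meson independent_span_bound order_trans)
  then have "closed (span B)"
    by (induction B rule: finite_induct) (simp_all add: closed_span_insert)
  moreover have "span B = W"
    using B assms(1) by (metis span_minimal subset_antisym)
  ultimately show ?thesis
    by simp
qed

lemma subspace_closure:
  fixes W :: "'a::real_normed_vector set"
  assumes "subspace W"
  shows "subspace (closure W)"
proof (rule subspaceI)
  show "0 \<in> closure W"
    using assms closure_subset subspace_0 by blast
  show "x + y \<in> closure W" if xy: "x \<in> closure W" "y \<in> closure W" for x y
  proof -
    obtain f g where fg: "\<forall>n. f n \<in> W" "f \<longlonglongrightarrow> x" "\<forall>n. g n \<in> W" "g \<longlonglongrightarrow> y"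
      using xy unfolding closure_sequential by blast
    have "\<forall>n. f n + g n \<in> W" "(\<lambda>n. f n + g n) \<longlonglongrightarrow> x + y"
      by (simp_all add: fg subspace_add[OF assms] tendsto_add)
    then show ?thesis
      unfolding closure_sequential by (intro exI conjI)
  qed
  show "c *\<^sub>R x \<in> closure W" if x: "x \<in> closure W" for c x
  proof -
    obtain f where f: "\<forall>n. f n \<in> W" "f \<longlonglongrightarrow> x"
      using x by (auto simp: closure_sequential)
    have "\<forall>n. c *\<^sub>R f n \<in> W" "(\<lambda>n. c *\<^sub>R f n) \<longlonglongrightarrow> c *\<^sub>R x"
      by (simp_all add: f subspace_scale[OF assms] tendsto_scaleR)
    then show ?thesis
      unfolding closure_sequential by (intro exI conjI)
  qed
qed

lemma linear_eval_blinfun: "linear (\<lambda>T. blinfun_apply T x)"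
  by (simp add: bounded_linear.linear blinfun.bounded_linear_left)

lemma linear_blinfun: "linear (blinfun_apply T)"
  by (simp add: bounded_linear.linear blinfun.bounded_linear_right)

lemma finite_rank_add:
  assumes "finite_rank S" "finite_rank T"
  shows "finite_rank (S + T)"
proof -
  obtain B C where "finite B" "range (blinfun_apply S) \<subseteq> span B" "finite C" "range (blinfun_apply T) \<subseteq> span C"
    using assms by (auto simp: finite_rank_def finite_dimensional_def)
  then have "finite (B \<union> C)" "range (blinfun_apply (S + T)) \<subseteq> span (B \<union> C)"
    by (auto simp: blinfun.add_left intro!: span_add intro: subsetD[OF span_mono, rotated])
  then show ?thesis
    unfolding finite_rank_def finite_dimensional_def by blast
qed

lemma finite_rank_compose_right: "finite_rank T \<Longrightarrow> finite_rank (T o\<^sub>L S)"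
  unfolding finite_rank_def by (erule finite_dimensional_mono) auto

lemma finite_rank_scale: "finite_rank T \<Longrightarrow> finite_rank (c *\<^sub>R T)"
  unfolding finite_rank_def
  using finite_dimensional_linear_image[OF linear_scaleR, of "range (blinfun_apply T)" c]
  by (simp add: image_image blinfun.scaleR_left)

lemma finite_rank_0: "finite_rank 0"
  by (auto simp: finite_rank_def finite_dimensional_def intro!: exI[of _ "{}"])

section \<open>The commutant of an L-algebra is a division algebra\<close>

locale L_alg =
  fixes A :: "('a::real_normed_vector \<Rightarrow>\<^sub>L 'a) set"
  assumes L_algebra: "L_algebra A"
begin

abbreviation F :: "('a \<Rightarrow>\<^sub>L 'a) set" where "F \<equiv> finite_rank_part A"

abbreviation V :: "'a set" where "V \<equiv> finite_rank_space A"

lemma subspace_A: "subspace A" and compose_A: "S \<in> A \<Longrightarrow> T \<in> A \<Longrightarrow> S o\<^sub>L T \<in> A"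
  using L_algebra by (auto simp: L_algebra_def operator_algebra_def)

lemma subspace_F: "subspace F"
  using subspace_A
  by (auto simp: finite_rank_part_def finite_rank_0 finite_rank_add finite_rank_scale subspace_def)

lemma subspace_V: "subspace V"
  by (simp add: finite_rank_space_def)

lemma F_apply_V: "T \<in> F \<Longrightarrow> blinfun_apply T x \<in> V"
  unfolding finite_rank_space_def by (rule span_base) blast

text \<open>The closure of an orbit is invariant, hence everything or zero. If it is zero, all operators
  in \<open>A\<close> vanish on the line through \<open>x\<close>, which is then invariant and hence the whole space; but
  \<open>A\<close> contains a non-zero operator.\<close>

lemma orbit_dense:
  assumes "x \<noteq> 0"
  shows "closure ((\<lambda>T. blinfun_apply T x) ` A) = UNIV" (is "closure ?O = UNIV")
proof (rule ccontr)
  assume nd: "closure ?O \<noteq> UNIV"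
  have inv: "blinfun_apply T ` closure ?O \<subseteq> closure ?O" if "T \<in> A" for T
  proof (rule image_closure_subset)
    show "blinfun_apply T ` ?O \<subseteq> closure ?O"
      using compose_A[OF that] closure_subset by (force simp: image_iff)
  qed (auto intro: linear_continuous_on blinfun.bounded_linear_right)
  have trans: "transitive A"
    using L_algebra by (simp add: L_algebra_def)
  have "subspace (closure ?O)"
    by (intro subspace_closure linear_subspace_image linear_eval_blinfun subspace_A)
  then have "closure ?O = {0}"
    using trans inv nd unfolding transitive_def by (metis closed_closure)
  then have zero: "blinfun_apply T x = 0" if "T \<in> A" for T
    using that closure_subset[of ?O] by blast
  have "blinfun_apply T ` span {x} \<subseteq> span {x}" if "T \<in> A" for T
    using zero[OF that] by (auto simp: span_singleton blinfun.scaleR_right)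
  moreover have "closed (span {x})"
    by (rule closed_finite_dimensional) (auto simp: finite_dimensional_def intro!: exI[of _ "{x}"])
  ultimately have "span {x} = {0} \<or> span {x} = UNIV"
    using trans unfolding transitive_def by (meson subspace_span)
  then have span: "span {x} = UNIV"
    using assms span_base by blast
  have "T = 0" if "T \<in> A" for T
  proof (rule blinfun_eqI)
    fix y
    have "y \<in> span {x}"
      by (simp add: span)
    then show "blinfun_apply T y = blinfun_apply 0 y"
      using zero[OF that] by (auto simp: span_singleton blinfun.scaleR_right)
  qed
  then show False
    using L_algebra by (auto simp: L_algebra_def)
qed

text \<open>For \<open>T\<close> in \<open>F\<close> the image under \<open>T\<close> of the dense orbit \<open>A x\<close> is dense in the range of \<open>T\<close>, and closed
  since it has finite dimension. So the operators \<open>T S\<close> with \<open>S\<close> in \<open>A\<close>, which lie in \<open>F\<close>, carry \<open>x\<close>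
  onto the range of \<open>T\<close>.\<close>

lemma orbit:
  assumes "x \<noteq> 0"
  shows "(\<lambda>T. blinfun_apply T x) ` F = V"
proof
  show "(\<lambda>T. blinfun_apply T x) ` F \<subseteq> V"
    using F_apply_V by blast
  let ?O = "(\<lambda>T. blinfun_apply T x) ` A"
  have range: "range (blinfun_apply T) \<subseteq> (\<lambda>T. blinfun_apply T x) ` F" if T: "T \<in> F" for T
  proof -
    have fr: "finite_rank T" and "T \<in> A"
      using T by (auto simp: finite_rank_part_def)
    have "subspace ?O"
      by (intro linear_subspace_image linear_eval_blinfun subspace_A)
    then have "subspace (blinfun_apply T ` ?O)"
      by (rule linear_subspace_image[OF linear_blinfun])
    moreover have "finite_dimensional (blinfun_apply T ` ?O)"
      using fr unfolding finite_rank_def by (rule finite_dimensional_mono) blast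
    ultimately have "closed (blinfun_apply T ` ?O)"
      by (rule closed_finite_dimensional)
    then have "blinfun_apply T ` closure ?O \<subseteq> blinfun_apply T ` ?O"
      by (intro image_closure_subset) (auto intro: linear_continuous_on blinfun.bounded_linear_right)
    then have "range (blinfun_apply T) \<subseteq> blinfun_apply T ` ?O"
      by (simp add: orbit_dense[OF assms])
    also have "\<dots> \<subseteq> (\<lambda>T. blinfun_apply T x) ` F"
    proof clarify
      fix S assume "S \<in> A"
      then have "T o\<^sub>L S \<in> F"
        using fr \<open>T \<in> A\<close> by (simp add: finite_rank_part_def compose_A finite_rank_compose_right)
      then show "blinfun_apply T (blinfun_apply S x) \<in> (\<lambda>T. blinfun_apply T x) ` F"
        by (force simp: image_iff)
    qed
    finally show ?thesis .
  qed
  show "V \<subseteq> (\<lambda>T. blinfun_apply T x) ` F"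
    unfolding finite_rank_space_def
    by (intro span_minimal linear_subspace_image linear_eval_blinfun subspace_F) (use range in blast)
qed

lemma transport:
  assumes "x \<noteq> 0" "y \<in> V"
  obtains T where "T \<in> F" "y = blinfun_apply T x"
  using orbit[OF assms(1)] assms(2) by auto

lemma exists_nonzero_V: obtains x where "x \<in> V" "x \<noteq> 0"
proof -
  obtain T where "T \<in> F" "T \<noteq> 0"
    using L_algebra by (auto simp: L_algebra_def finite_rank_part_def)
  moreover from this obtain x where "blinfun_apply T x \<noteq> 0"
    using blinfun_eqI[of T 0] by auto
  ultimately show thesis
    using that F_apply_V by blast
qed

lemma commutantD:
  assumes "S \<in> commutant A"
  shows "x \<in> V \<Longrightarrow> S x \<in> V" "x \<notin> V \<Longrightarrow> S x = 0"
    "x \<in> V \<Longrightarrow> y \<in> V \<Longrightarrow> S (x + y) = S x + S y"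
    "x \<in> V \<Longrightarrow> S (r *\<^sub>R x) = r *\<^sub>R S x"
    "T \<in> F \<Longrightarrow> x \<in> V \<Longrightarrow> S (blinfun_apply T x) = blinfun_apply T (S x)"
proof -
  have S: "S ` V \<subseteq> V \<and> (\<forall>x. x \<notin> V \<longrightarrow> S x = 0) \<and> (\<forall>x\<in>V. \<forall>y\<in>V. S (x + y) = S x + S y) \<and>
      (\<forall>r. \<forall>x\<in>V. S (r *\<^sub>R x) = r *\<^sub>R S x) \<and>
      (\<forall>T\<in>F. \<forall>x\<in>V. S (blinfun_apply T x) = blinfun_apply T (S x))"
    using assms unfolding commutant_def mem_Collect_eq .
  note S1 = S[THEN conjunct1] and S2 = S[THEN conjunct2]
  note S3 = S2[THEN conjunct2] note S4 = S3[THEN conjunct2]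
  show "x \<in> V \<Longrightarrow> S x \<in> V"
    using S1 by blast
  show "x \<notin> V \<Longrightarrow> S x = 0"
    by (rule S2[THEN conjunct1, rule_format])
  show "x \<in> V \<Longrightarrow> y \<in> V \<Longrightarrow> S (x + y) = S x + S y"
    by (rule S3[THEN conjunct1, rule_format])
  show "x \<in> V \<Longrightarrow> S (r *\<^sub>R x) = r *\<^sub>R S x"
    by (rule S4[THEN conjunct1, rule_format])
  show "T \<in> F \<Longrightarrow> x \<in> V \<Longrightarrow> S (blinfun_apply T x) = blinfun_apply T (S x)"
    by (rule S4[THEN conjunct2, rule_format])
qed

lemma commutant_0_right: "S \<in> commutant A \<Longrightarrow> S 0 = 0"
  using commutantD(4)[of S 0 0] subspace_0[OF subspace_V] by simp

lemma commutant_range: "S \<in> commutant A \<Longrightarrow> S x \<in> V"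
  using commutantD(1,2) subspace_0[OF subspace_V] by metis

text \<open>Every vector of \<open>V\<close> is \<open>T x\<close> for some \<open>T\<close> in \<open>F\<close>, and \<open>S (T x) = T (S x)\<close>.\<close>

lemma commutant_eqI:
  assumes S: "S \<in> commutant A" and S': "S' \<in> commutant A" and x: "x \<in> V" "x \<noteq> 0" "S x = S' x"
  shows "S = S'"
proof
  fix y
  show "S y = S' y"
  proof (cases "y \<in> V")
    case True
    then obtain T where T: "T \<in> F" "y = blinfun_apply T x"
      using transport x(2) by blast
    then show ?thesis
      using commutantD(5)[OF S T(1) x(1)] commutantD(5)[OF S' T(1) x(1)] x(3) by simp
  qed (simp add: commutantD(2)[OF S] commutantD(2)[OF S'])
qed

lemma commutantI:
  assumes "\<And>x. x \<in> V \<Longrightarrow> S x \<in> V" "\<And>x. x \<notin> V \<Longrightarrow> S x = 0"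
    "\<And>x y. x \<in> V \<Longrightarrow> y \<in> V \<Longrightarrow> S (x + y) = S x + S y"
    "\<And>r x. x \<in> V \<Longrightarrow> S (r *\<^sub>R x) = r *\<^sub>R S x"
    "\<And>T x. T \<in> F \<Longrightarrow> x \<in> V \<Longrightarrow> S (blinfun_apply T x) = blinfun_apply T (S x)"
  shows "S \<in> commutant A"
  unfolding commutant_def mem_Collect_eq
  by (intro conjI ballI allI impI image_subsetI) (rule assms, assumption+)+

lemma commutant_zero: "(\<lambda>x. 0) \<in> commutant A"
  by (rule commutantI) (simp_all add: subspace_0[OF subspace_V])

lemma commutant_one: "(\<lambda>x. if x \<in> V then x else 0) \<in> commutant A"
  by (rule commutantI) (simp_all add: F_apply_V subspace_add[OF subspace_V] subspace_scale[OF subspace_V])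

lemma commutant_add:
  assumes S: "S \<in> commutant A" and T: "T \<in> commutant A"
  shows "(\<lambda>x. S x + T x) \<in> commutant A"
  by (rule commutantI)
    (simp_all add: commutantD[OF S] commutantD[OF T] subspace_add[OF subspace_V] scaleR_add_right
      blinfun.add_right)

lemma commutant_scale:
  assumes S: "S \<in> commutant A"
  shows "(\<lambda>x. r *\<^sub>R S x) \<in> commutant A"
  by (rule commutantI)
    (simp_all add: commutantD[OF S] subspace_scale[OF subspace_V] scaleR_add_right blinfun.scaleR_right)

lemma commutant_compose:
  assumes S: "S \<in> commutant A" and T: "T \<in> commutant A"
  shows "S \<circ> T \<in> commutant A"
  by (rule commutantI)
    (simp_all add: commutantD[OF S] commutantD[OF T] commutant_0_right[OF S])

text \<open>Schur's lemma: \<open>S\<close> has trivial kernel by lemma \<open>commutant_eqI\<close>, and its range contains the full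
  orbit of some non-zero \<open>S x\<close>.\<close>

lemma commutant_left_inverse:
  assumes S: "S \<in> commutant A" and nz: "S \<noteq> (\<lambda>x. 0)"
  obtains R where "R \<in> commutant A" "R \<circ> S = (\<lambda>x. if x \<in> V then x else 0)"
proof -
  have ker: "S x \<noteq> 0" if "x \<in> V" "x \<noteq> 0" for x
    using commutant_eqI[OF S commutant_zero that] nz by auto
  have inj: "inj_on S V"
  proof (rule inj_onI)
    fix x y assume xy: "x \<in> V" "y \<in> V" "S x = S y"
    have "S (x + (- 1) *\<^sub>R y) = S x + (- 1) *\<^sub>R S y"
      using commutantD(3)[OF S, of x "(- 1) *\<^sub>R y"] commutantD(4)[OF S, of y "- 1"] xy subspace_V
      by (simp only: subspace_scale)
    then have "S (x - y) = 0"
      using xy(3) by simp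
    then show "x = y"
      using ker[of "x - y"] xy subspace_V by (auto simp: subspace_diff)
  qed
  have onto: "S ` V = V"
  proof
    obtain x where x: "x \<in> V" "x \<noteq> 0"
      by (rule exists_nonzero_V)
    show "V \<subseteq> S ` V"
    proof
      fix y assume "y \<in> V"
      then obtain T where T: "T \<in> F" "y = blinfun_apply T (S x)"
        using transport ker[OF x] by metis
      then show "y \<in> S ` V"
        using commutantD(5)[OF S T(1) x(1)] F_apply_V[OF T(1)] by (metis image_eqI)
    qed
  qed (use commutantD(1)[OF S] in blast)
  define R where "R y = (if y \<in> V then the_inv_into V S y else 0)" for y
  have RS: "R (S x) = x" if "x \<in> V" for x
    using that by (simp add: R_def the_inv_into_f_f[OF inj] commutantD(1)[OF S])
  have R_V: "R y \<in> V" "S (R y) = y" if "y \<in> V" for y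
    using that the_inv_into_into[OF inj, of y V] f_the_inv_into_f[OF inj, of y] onto by (auto simp: R_def)
  have "R \<in> commutant A"
  proof (rule commutantI)
    show "R x \<in> V" if "x \<in> V" for x
      using that by (rule R_V)
    show "R x = 0" if "x \<notin> V" for x
      using that by (simp add: R_def)
    show "R (x + y) = R x + R y" if "x \<in> V" "y \<in> V" for x y
      using RS[of "R x + R y"] that R_V commutantD(3)[OF S, of "R x" "R y"] subspace_V
      by (simp add: subspace_add)
    show "R (r *\<^sub>R x) = r *\<^sub>R R x" if "x \<in> V" for r x
      using RS[of "r *\<^sub>R R x"] that R_V commutantD(4)[OF S, of "R x"] subspace_V
      by (simp add: subspace_scale)
    show "R (blinfun_apply T x) = blinfun_apply T (R x)" if "T \<in> F" "x \<in> V" for T x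
      using RS[of "blinfun_apply T (R x)"] that R_V commutantD(5)[OF S, of T "R x"]
      by (simp add: F_apply_V)
  qed
  moreover have "R \<circ> S = (\<lambda>x. if x \<in> V then x else 0)"
    using RS commutantD(2)[OF S] commutant_0_right[OF \<open>R \<in> _\<close>] by auto
  ultimately show thesis
    using that by blast
qed

text \<open>If \<open>T\<close> in \<open>F\<close> fixes \<open>w\<close>, then \<open>S w = T (S w)\<close> lies in the range of \<open>T\<close> for all \<open>S\<close> in the commutant.\<close>

lemma commutant_finite_orbit:
  obtains w where "w \<in> V" "w \<noteq> 0" "finite_dimensional ((\<lambda>S. S w) ` commutant A)"
proof -
  obtain x where x: "x \<in> V" "x \<noteq> 0"
    by (rule exists_nonzero_V)
  then obtain T where T: "T \<in> F" "x = blinfun_apply T x"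
    using transport by blast
  have "(\<lambda>S. S x) ` commutant A \<subseteq> range (blinfun_apply T)"
  proof clarify
    fix S assume "S \<in> commutant A"
    then have "S x = blinfun_apply T (S x)"
      using commutantD(5)[of S T x] T x by simp
    then show "S x \<in> range (blinfun_apply T)"
      by (metis rangeI)
  qed
  moreover have "finite_dimensional (range (blinfun_apply T))"
    using T(1) by (simp add: finite_rank_part_def finite_rank_def)
  ultimately show thesis
    using that x finite_dimensional_mono by blast
qed

end

section \<open>Every L-algebra has a type\<close>

text \<open>The commutant is a set of partial linear maps extended by zero. To apply the theorem of Frobenius, it
  is moved into the algebra of linear endomorphisms of the whole space.\<close>

typedef (overloaded) 'a endo = "{f :: 'a::real_vector \<Rightarrow> 'a. linear f}"
  morphisms apply_endo Endo
  by (rule exI[of _ id]) (simp add: linear_id)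

setup_lifting type_definition_endo

instantiation endo :: (real_vector) real_algebra
begin

lift_definition zero_endo :: "'a endo" is "\<lambda>x. 0"
  by (simp add: linear_iff)

lift_definition plus_endo :: "'a endo \<Rightarrow> 'a endo \<Rightarrow> 'a endo" is "\<lambda>f g x. f x + g x"
  by (simp add: linear_compose_add)

lift_definition minus_endo :: "'a endo \<Rightarrow> 'a endo \<Rightarrow> 'a endo" is "\<lambda>f g x. f x - g x"
  by (simp add: linear_compose_sub)

lift_definition uminus_endo :: "'a endo \<Rightarrow> 'a endo" is "\<lambda>f x. - f x"
  by (simp add: linear_compose_neg)

lift_definition scaleR_endo :: "real \<Rightarrow> 'a endo \<Rightarrow> 'a endo" is "\<lambda>r f x. r *\<^sub>R f x"
  by (simp add: linear_compose_scale_right)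

lift_definition times_endo :: "'a endo \<Rightarrow> 'a endo \<Rightarrow> 'a endo" is "\<lambda>f g. f \<circ> g"
  by (simp add: linear_compose)

instance
  by standard (transfer; simp add: fun_eq_iff algebra_simps linear_add linear_scale)+

end

lemma real_algebra_iso_bij:
  "real_algebra_iso D \<phi> \<Longrightarrow> bij_betw \<phi> D UNIV"
  by (simp add: real_algebra_iso_def)

lemma real_algebra_iso_compose:
  assumes \<phi>: "real_algebra_iso D \<phi>" and bij: "bij_betw \<rho> D' D"
    and add: "\<And>S T. S \<in> D' \<Longrightarrow> T \<in> D' \<Longrightarrow> \<rho> (\<lambda>x. S x + T x) = (\<lambda>x. \<rho> S x + \<rho> T x)"
    and scale: "\<And>r S. S \<in> D' \<Longrightarrow> \<rho> (\<lambda>x. r *\<^sub>R S x) = (\<lambda>x. r *\<^sub>R \<rho> S x)"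
    and comp: "\<And>S T. S \<in> D' \<Longrightarrow> T \<in> D' \<Longrightarrow> \<rho> (S \<circ> T) = \<rho> S \<circ> \<rho> T"
  shows "real_algebra_iso D' (\<phi> \<circ> \<rho>)"
proof -
  have \<rho>: "\<rho> S \<in> D" if "S \<in> D'" for S
    using bij that by (rule bij_betwE[THEN bspec])
  have "bij_betw (\<phi> \<circ> \<rho>) D' UNIV"
    using bij real_algebra_iso_bij[OF \<phi>] by (rule bij_betw_trans)
  then show ?thesis
    using \<phi> by (simp add: real_algebra_iso_def add scale comp \<rho>)
qed

lemma real_algebra_iso_inv:
  fixes E :: "('a::real_vector \<Rightarrow> 'a) \<Rightarrow> 'b::real_algebra" and \<psi> :: "'k::real_algebra_1 \<Rightarrow> 'b"
  assumes \<psi>: "algebra_iso_onto D' \<psi>" and E: "bij_betw E D D'"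
    and add: "\<And>S T. S \<in> D \<Longrightarrow> T \<in> D \<Longrightarrow> E (\<lambda>x. S x + T x) = E S + E T"
    and scale: "\<And>S r. S \<in> D \<Longrightarrow> E (\<lambda>x. r *\<^sub>R S x) = r *\<^sub>R E S"
    and comp: "\<And>S T. S \<in> D \<Longrightarrow> T \<in> D \<Longrightarrow> E (S \<circ> T) = E S * E T"
  shows "real_algebra_iso D (\<lambda>S. inv \<psi> (E S))"
proof -
  have lin: "linear \<psi>" and bij: "bij_betw \<psi> UNIV D'"
    and mult: "\<psi> (x * y) = \<psi> x * \<psi> y" for x y
    using \<psi> by (simp_all add: algebra_iso_onto_def)
  have inj: "inj \<psi>"
    using bij by (simp add: bij_betw_def)
  have inv: "\<psi> (inv \<psi> (E S)) = E S" if "S \<in> D" for S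
    using bij_betw_inv_into_right[OF bij] bij_betwE[OF E] that by blast
  have inv_eq: "inv \<psi> y = x" if "\<psi> x = y" for x y
    using that inj by auto
  have "bij_betw (\<lambda>S. inv \<psi> (E S)) D UNIV"
    using bij_betw_trans[OF E bij_betw_inv_into[OF bij]] by (simp add: comp_def)
  moreover have "inv \<psi> (E S + E T) = inv \<psi> (E S) + inv \<psi> (E T)"
    "inv \<psi> (r *\<^sub>R E S) = r *\<^sub>R inv \<psi> (E S)"
    "inv \<psi> (E S * E T) = inv \<psi> (E S) * inv \<psi> (E T)" if "S \<in> D" "T \<in> D" for S T r
    using that by (auto intro!: inv_eq simp: linear_add[OF lin] linear_scale[OF lin] mult inv)
  ultimately show ?thesis
    by (simp add: real_algebra_iso_def add scale comp)
qed

text \<open>Composition with a linear projection \<open>Q\<close> onto \<open>V\<close> turns a member of the commutant into an endomorphism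
  of the whole space. This is multiplicative because members of the commutant map \<open>V\<close> into itself, where
  \<open>Q\<close> is the identity; the unit of the image is \<open>Q\<close>.\<close>

lemma (in L_alg) commutant_type:
  obtains t where "of_type t A"
proof -
  obtain Q :: "'a \<Rightarrow> 'a" where Q: "range Q \<subseteq> V" "linear Q" "\<And>v. v \<in> V \<Longrightarrow> Q v = v"
    using linear_exists_left_inverse_on[OF linear_id subspace_V] by auto
  have QV: "Q x \<in> V" for x
    using Q(1) by blast
  define E where "E S = Endo (S \<circ> Q)" for S
  have "linear (S \<circ> Q)" if S: "S \<in> commutant A" for S
    by (rule linearI) (simp_all add: linear_add[OF Q(2)] linear_scale[OF Q(2)] commutantD[OF S] QV)
  then have E: "apply_endo (E S) x = S (Q x)" if "S \<in> commutant A" for S x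
    using that by (simp add: E_def Endo_inverse)
  have E_add: "E (\<lambda>x. S x + T x) = E S + E T" if "S \<in> commutant A" "T \<in> commutant A" for S T
    using that by (simp add: apply_endo_inject[symmetric] fun_eq_iff plus_endo.rep_eq E commutant_add)
  have E_scale: "E (\<lambda>x. r *\<^sub>R S x) = r *\<^sub>R E S" if "S \<in> commutant A" for S r
    using that by (simp add: apply_endo_inject[symmetric] fun_eq_iff scaleR_endo.rep_eq E commutant_scale)
  have E_comp: "E (S \<circ> T) = E S * E T" if "S \<in> commutant A" "T \<in> commutant A" for S T
    using that commutantD(1)[OF that(2) QV] commutant_compose[OF that]
    by (simp add: apply_endo_inject[symmetric] fun_eq_iff times_endo.rep_eq E Q(3))
  have E_inj: "inj_on E (commutant A)"
  proof (rule inj_onI)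
    fix S T assume S: "S \<in> commutant A" and T: "T \<in> commutant A" and eq: "E S = E T"
    obtain x where x: "x \<in> V" "x \<noteq> 0"
      by (rule exists_nonzero_V)
    have "S x = T x"
      using E[OF S, of x] E[OF T, of x] eq Q(3)[OF x(1)] by simp
    then show "S = T"
      by (rule commutant_eqI[OF S T x])
  qed
  have E_zero: "E (\<lambda>x. 0) = 0"
    using E_scale[OF commutant_zero, of 0] by simp
  define one where "one = (\<lambda>x. if x \<in> V then x else 0)"
  have one: "one \<in> commutant A"
    unfolding one_def by (rule commutant_one)
  have one_id: "one \<circ> S = S" "S \<circ> one = S" if S: "S \<in> commutant A" for S
    by (simp_all add: one_def fun_eq_iff commutant_range[OF S] commutantD(2)[OF S] commutant_0_right[OF S])
  interpret D: division_subalgebra "E ` commutant A" "E one"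
  proof
    show sub: "subspace (E ` commutant A)"
    proof (rule subspaceI)
      show "0 \<in> E ` commutant A"
        using imageI[OF commutant_zero, of E] by (simp only: E_zero)
      show "x + y \<in> E ` commutant A" if in_E: "x \<in> E ` commutant A" "y \<in> E ` commutant A" for x y
      proof -
        obtain S T where ST: "S \<in> commutant A" "T \<in> commutant A" and xy: "x = E S" "y = E T"
          using in_E by blast
        show ?thesis
          unfolding xy E_add[OF ST, symmetric] by (rule imageI[OF commutant_add[OF ST]])
      qed
      show "c *\<^sub>R x \<in> E ` commutant A" if in_E: "x \<in> E ` commutant A" for c x
      proof -
        obtain S where S: "S \<in> commutant A" and x: "x = E S"
          using in_E by blast
        show ?thesis
          unfolding x E_scale[OF S, symmetric] by (rule imageI[OF commutant_scale[OF S]])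
      qed
    qed
    show "x * y \<in> E ` commutant A" if in_E: "x \<in> E ` commutant A" "y \<in> E ` commutant A" for x y
    proof -
      obtain S T where ST: "S \<in> commutant A" "T \<in> commutant A" and xy: "x = E S" "y = E T"
        using in_E by blast
      show ?thesis
        unfolding xy E_comp[OF ST, symmetric] by (rule imageI[OF commutant_compose[OF ST]])
    qed
    show "E one \<in> E ` commutant A"
      using one by blast
    show "E one \<noteq> 0"
    proof
      assume "E one = 0"
      then have one_0: "one = (\<lambda>x. 0)"
        by (intro inj_onD[OF E_inj _ one commutant_zero]) (simp add: E_zero)
      obtain x where x: "x \<in> V" "x \<noteq> 0"
        by (rule exists_nonzero_V)
      have "one x = 0"
        by (simp only: one_0)
      with x show False
        by (simp add: one_def)
    qed
    show "E one * x = x" "x * E one = x" if in_E: "x \<in> E ` commutant A" for x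
    proof -
      obtain S where S: "S \<in> commutant A" and x: "x = E S"
        using in_E by blast
      show "E one * x = x" "x * E one = x"
        unfolding x E_comp[OF one S, symmetric] E_comp[OF S one, symmetric] one_id[OF S]
        by (rule refl)+
    qed
    show "\<exists>y\<in>E ` commutant A. y * x = E one" if x: "x \<in> E ` commutant A" "x \<noteq> 0" for x
    proof -
      obtain S where S: "S \<in> commutant A" "x = E S"
        using x(1) by blast
      have "S \<noteq> (\<lambda>x. 0)"
      proof
        assume "S = (\<lambda>x. 0)"
        with S(2) have "x = 0"
          by (simp only: E_zero)
        with x(2) show False ..
      qed
      then obtain R where R: "R \<in> commutant A" "R \<circ> S = one"
        unfolding one_def by (rule commutant_left_inverse[OF S(1)])
      show ?thesis
      proof (rule bexI)
        show "E R * x = E one"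
          unfolding S(2) E_comp[OF R(1) S(1), symmetric] R(2) by (rule refl)
      qed (rule imageI[OF R(1)])
    qed
    show "finite_dimensional (E ` commutant A)"
    proof -
      obtain w where w: "w \<in> V" "w \<noteq> 0" "finite_dimensional ((\<lambda>S. S w) ` commutant A)"
        by (rule commutant_finite_orbit)
      have Ew: "apply_endo (E S) w = S w" if "S \<in> commutant A" for S
        using E[OF that] Q(3)[OF w(1)] by simp
      show ?thesis
      proof (rule finite_dimensional_linear_inj)
        show "linear (\<lambda>T. apply_endo T w)"
          by (rule linearI) (simp_all add: plus_endo.rep_eq scaleR_endo.rep_eq)
        show "inj_on (\<lambda>T. apply_endo T w) (E ` commutant A)"
        proof (intro inj_onI, elim imageE)
          fix x y S T
          assume S: "S \<in> commutant A" "x = E S" and T: "T \<in> commutant A" "y = E T"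
            and eq: "apply_endo x w = apply_endo y w"
          then have "S w = T w"
            using Ew by simp
          then show "x = y"
            using commutant_eqI[OF S(1) T(1) w(1,2)] S T by simp
        qed
        show "finite_dimensional ((\<lambda>T. apply_endo T w) ` E ` commutant A)"
          using w(3) by (simp add: image_image Ew cong: image_cong)
      qed (rule sub)
    qed
  qed
  note iso = real_algebra_iso_inv[OF _ inj_on_imp_bij_betw[OF E_inj] E_add E_scale E_comp]
  from D.frobenius show thesis
  proof (elim disjE exE)
    fix \<psi> :: "real \<Rightarrow> 'a endo"
    assume "algebra_iso_onto (E ` commutant A) \<psi>"
    then have "of_type Real_Type A"
      unfolding of_type.simps by (intro exI) (rule iso)
    then show thesis
      by (rule that)
  next
    fix \<psi> :: "complex \<Rightarrow> 'a endo"
    assume "algebra_iso_onto (E ` commutant A) \<psi>"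
    then have "of_type Complex_Type A"
      unfolding of_type.simps by (intro exI) (rule iso)
    then show thesis
      by (rule that)
  next
    fix \<psi> :: "quaternion \<Rightarrow> 'a endo"
    assume "algebra_iso_onto (E ` commutant A) \<psi>"
    then have "of_type Quaternion_Type A"
      unfolding of_type.simps by (intro exI) (rule iso)
    then show thesis
      by (rule that)
  qed
qed

section \<open>Restriction between nested L-algebras\<close>

text \<open>Identifying quaternions with pairs of complex numbers reduces this to linear maps of a euclidean
  space.\<close>

lemma quaternion_linear_inj_surj:
  fixes f :: "quaternion \<Rightarrow> quaternion"
  assumes "linear f" "inj f"
  shows "surj f"
proof -
  define h where "h z = Quaternion (Re (fst z)) (Im (fst z)) (Re (snd z)) (Im (snd z))" for z
  define g where "g q = (Complex (qre q) (qi q), Complex (qj q) (qk q))" for q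
  have gh: "g (h z) = z" and hg: "h (g q) = q" for z q
    by (simp_all add: g_def h_def)
  have "linear h" "linear g"
    by (simp_all add: linear_iff g_def h_def plus_quaternion_def scaleR_quaternion_def complex_eq_iff)
  moreover have "inj h"
    by (rule inj_on_inverseI[where g = g]) (rule gh)
  moreover have "inj g"
    by (rule inj_on_inverseI[where g = h]) (rule hg)
  ultimately have "linear (g \<circ> f \<circ> h)" "inj (g \<circ> f \<circ> h)"
    using assms by (simp_all add: linear_compose inj_compose)
  then have "surj (g \<circ> f \<circ> h)"
    by (rule linear_injective_imp_surjective) simp
  show ?thesis
  proof (rule surjI)
    fix y
    have "(g \<circ> f \<circ> h) (inv (g \<circ> f \<circ> h) (g y)) = g y"
      by (rule surj_f_inv_f) fact
    then have "h (g (f (h (inv (g \<circ> f \<circ> h) (g y))))) = h (g y)"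
      by simp
    then show "f (h (inv (g \<circ> f \<circ> h) (g y))) = y"
      by (simp only: hg)
  qed
qed

definition restrict_zero :: "'a set \<Rightarrow> ('a \<Rightarrow> 'b::zero) \<Rightarrow> 'a \<Rightarrow> 'b" where
  "restrict_zero V S x = (if x \<in> V then S x else 0)"

lemma restrict_zero_apply [simp]: "x \<in> V \<Longrightarrow> restrict_zero V S x = S x"
  and restrict_zero_outside [simp]: "x \<notin> V \<Longrightarrow> restrict_zero V S x = 0"
  by (simp_all add: restrict_zero_def)

locale L_alg_pair = A: L_alg A + B: L_alg B for A B :: "('a::real_normed_vector \<Rightarrow>\<^sub>L 'a) set" +
  assumes subset: "A \<subseteq> B"
begin

lemma F_subset: "A.F \<subseteq> B.F"
  using subset by (auto simp: finite_rank_part_def)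

lemma V_subset: "A.V \<subseteq> B.V"
  unfolding finite_rank_space_def using F_subset by (intro span_mono) blast

text \<open>A non-zero \<open>x\<close> in the small space is fixed by some finite rank operator \<open>T\<close> of \<open>A\<close>, whence
  \<open>S x = T (S x)\<close> is in the range of \<open>T\<close>.\<close>

lemma commutant_preserves:
  assumes S: "S \<in> commutant B" and x: "x \<in> A.V"
  shows "S x \<in> A.V"
proof (cases "x = 0")
  case True
  then show ?thesis
    using B.commutant_0_right[OF S] x by simp
next
  case False
  obtain T where T: "T \<in> A.F" "x = blinfun_apply T x"
    by (rule A.transport[OF False x])
  have "S x = S (blinfun_apply T x)"
    using T(2) by (rule arg_cong)
  also have "\<dots> = blinfun_apply T (S x)"
    using T(1) x F_subset V_subset by (intro B.commutantD(5)[OF S]) blast+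
  also have "\<dots> \<in> A.V"
    by (rule A.F_apply_V[OF T(1)])
  finally show ?thesis .
qed

lemma restrict_commutant:
  assumes S: "S \<in> commutant B"
  shows "restrict_zero A.V S \<in> commutant A"
proof (rule A.commutantI)
  have V: "x \<in> B.V" if "x \<in> A.V" for x
    using that V_subset by blast
  show "restrict_zero A.V S (x + y) = restrict_zero A.V S x + restrict_zero A.V S y"
    if "x \<in> A.V" "y \<in> A.V" for x y
    using that by (simp add: subspace_add[OF A.subspace_V] B.commutantD(3)[OF S] V)
  show "restrict_zero A.V S (r *\<^sub>R x) = r *\<^sub>R restrict_zero A.V S x" if "x \<in> A.V" for r x
    using that by (simp add: subspace_scale[OF A.subspace_V] B.commutantD(4)[OF S] V)
  show "restrict_zero A.V S (blinfun_apply T x) = blinfun_apply T (restrict_zero A.V S x)"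
    if "T \<in> A.F" "x \<in> A.V" for T x
    using that F_subset by (simp add: A.F_apply_V B.commutantD(5)[OF S] V subsetD)
qed (simp_all add: commutant_preserves[OF S])

lemma restrict_inj: "inj_on (restrict_zero A.V) (commutant B)"
proof (rule inj_onI)
  fix S T assume S: "S \<in> commutant B" and T: "T \<in> commutant B"
    and eq: "restrict_zero A.V S = restrict_zero A.V T"
  obtain x where x: "x \<in> A.V" "x \<noteq> 0"
    by (rule A.exists_nonzero_V)
  then have "S x = T x"
    using eq by (metis restrict_zero_apply)
  then show "S = T"
    using B.commutant_eqI[OF S T _ x(2)] x(1) V_subset by blast
qed

lemma restrict_compose:
  assumes "S \<in> commutant B" "T \<in> commutant B"
  shows "restrict_zero A.V (S \<circ> T) = restrict_zero A.V S \<circ> restrict_zero A.V T"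
proof
  fix x
  show "restrict_zero A.V (S \<circ> T) x = (restrict_zero A.V S \<circ> restrict_zero A.V T) x"
    using commutant_preserves[OF assms(2)] B.commutant_0_right[OF assms(1)]
    by (cases "x \<in> A.V"; cases "0 \<in> A.V") simp_all
qed

text \<open>Read through the two isomorphisms, restriction is an injective linear map of \<open>'k\<close> into itself; the
  hypothesis \<open>surj\<close> is what finite dimension of \<open>'k\<close> contributes.\<close>

lemma restrict_onto_if_iso:
  fixes \<phi> \<phi>' :: "('a \<Rightarrow> 'a) \<Rightarrow> 'k::real_algebra_1"
  assumes \<phi>: "real_algebra_iso (commutant A) \<phi>" and \<phi>': "real_algebra_iso (commutant B) \<phi>'"
    and surj: "\<And>f :: 'k \<Rightarrow> 'k. linear f \<Longrightarrow> inj f \<Longrightarrow> surj f"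
  shows "restrict_zero A.V ` commutant B = commutant A"
proof -
  let ?\<rho> = "restrict_zero A.V"
  define \<psi> where "\<psi> = inv_into (commutant B) \<phi>'"
  have bij': "bij_betw \<phi>' (commutant B) UNIV" and bij: "bij_betw \<phi> (commutant A) UNIV"
    using \<phi> \<phi>' by (simp_all add: real_algebra_iso_def)
  have \<psi>_bij: "bij_betw \<psi> UNIV (commutant B)"
    unfolding \<psi>_def by (rule bij_betw_inv_into[OF bij'])
  have \<psi>: "\<psi> k \<in> commutant B" "\<phi>' (\<psi> k) = k" for k
    using \<psi>_bij bij_betw_inv_into_right[OF bij'] by (auto simp: \<psi>_def bij_betw_def)
  have \<psi>_eq: "\<psi> (\<phi>' S) = S" if "S \<in> commutant B" for S
    unfolding \<psi>_def by (rule bij_betw_inv_into_left[OF bij' that])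
  have \<psi>_add: "\<psi> (k + l) = (\<lambda>x. \<psi> k x + \<psi> l x)" for k l
    using \<psi>_eq[OF B.commutant_add[OF \<psi>(1)[of k] \<psi>(1)[of l]]] \<phi>' \<psi> by (simp add: real_algebra_iso_def)
  have \<psi>_scale: "\<psi> (r *\<^sub>R k) = (\<lambda>x. r *\<^sub>R \<psi> k x)" for r k
    using \<psi>_eq[OF B.commutant_scale[OF \<psi>(1)[of k], of r]] \<phi>' \<psi> by (simp add: real_algebra_iso_def)
  define f where "f k = \<phi> (?\<rho> (\<psi> k))" for k
  have \<rho>: "?\<rho> (\<psi> k) \<in> commutant A" for k
    by (rule restrict_commutant[OF \<psi>(1)])
  have "linear f"
  proof (rule linearI)
    fix k l :: 'k and r
    have "?\<rho> (\<psi> (k + l)) = (\<lambda>x. ?\<rho> (\<psi> k) x + ?\<rho> (\<psi> l) x)"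
      by (simp add: \<psi>_add fun_eq_iff restrict_zero_def)
    then show "f (k + l) = f k + f l"
      using \<phi> \<rho> by (simp add: f_def real_algebra_iso_def)
    have "?\<rho> (\<psi> (r *\<^sub>R k)) = (\<lambda>x. r *\<^sub>R ?\<rho> (\<psi> k) x)"
      by (simp add: \<psi>_scale fun_eq_iff restrict_zero_def)
    then show "f (r *\<^sub>R k) = r *\<^sub>R f k"
      using \<phi> \<rho> by (simp add: f_def real_algebra_iso_def)
  qed
  moreover have "inj f"
  proof (rule injI)
    fix k l assume "f k = f l"
    then have "?\<rho> (\<psi> k) = ?\<rho> (\<psi> l)"
      using bij \<rho> by (auto simp: f_def bij_betw_def dest: inj_onD)
    then have "\<psi> k = \<psi> l"
      using restrict_inj \<psi>(1) by (metis inj_onD)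
    then show "k = l"
      by (metis \<psi>(2))
  qed
  ultimately have "surj f"
    by (rule surj)
  have "S \<in> ?\<rho> ` commutant B" if S: "S \<in> commutant A" for S
  proof -
    obtain k where "\<phi> S = f k"
      using \<open>surj f\<close> by (metis surjD)
    then have "S = ?\<rho> (\<psi> k)"
      using bij S \<rho> by (auto simp: f_def bij_betw_def dest: inj_onD)
    then show ?thesis
      using \<psi>(1) by blast
  qed
  then show ?thesis
    using restrict_commutant by blast
qed

lemma restrict_onto:
  assumes "of_type t A" "of_type t B"
  shows "restrict_zero A.V ` commutant B = commutant A"
proof (cases t)
  case Real_Type
  then obtain \<phi> \<phi>' :: "('a \<Rightarrow> 'a) \<Rightarrow> real"
    where "real_algebra_iso (commutant A) \<phi>" "real_algebra_iso (commutant B) \<phi>'"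
    using assms by auto
  then show ?thesis
    by (rule restrict_onto_if_iso) (rule linear_injective_imp_surjective, simp_all)
next
  case Complex_Type
  then obtain \<phi> \<phi>' :: "('a \<Rightarrow> 'a) \<Rightarrow> complex"
    where "real_algebra_iso (commutant A) \<phi>" "real_algebra_iso (commutant B) \<phi>'"
    using assms by auto
  then show ?thesis
    by (rule restrict_onto_if_iso) (rule linear_injective_imp_surjective, simp_all)
next
  case Quaternion_Type
  then obtain \<phi> \<phi>' :: "('a \<Rightarrow> 'a) \<Rightarrow> quaternion"
    where "real_algebra_iso (commutant A) \<phi>" "real_algebra_iso (commutant B) \<phi>'"
    using assms by auto
  then show ?thesis
    by (rule restrict_onto_if_iso) (rule quaternion_linear_inj_surj)
qed

lemma iso_if_restrict_onto:
  assumes "restrict_zero A.V ` commutant B = commutant A" and "real_algebra_iso (commutant A) \<phi>"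
  shows "real_algebra_iso (commutant B) (\<phi> \<circ> restrict_zero A.V)"
proof (rule real_algebra_iso_compose[OF assms(2)])
  show "bij_betw (restrict_zero A.V) (commutant B) (commutant A)"
    using restrict_inj assms(1) by (simp add: bij_betw_def)
qed (simp_all add: restrict_compose restrict_zero_def fun_eq_iff)

lemma of_type_if_restrict_onto:
  assumes "restrict_zero A.V ` commutant B = commutant A" and "of_type t A"
  shows "of_type t B"
  using assms(2) by (cases t) (auto intro: iso_if_restrict_onto[OF assms(1)])

end

lemma transitive_mono: "transitive A \<Longrightarrow> A \<subseteq> B \<Longrightarrow> transitive B"
  unfolding transitive_def by (meson subsetD)

section \<open>Unions of chains and maximal L-algebras\<close>

locale L_alg_chain =
  fixes \<C> :: "('a::real_normed_vector \<Rightarrow>\<^sub>L 'a) set set"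
  assumes nonempty: "\<C> \<noteq> {}"
    and L_algebras: "B \<in> \<C> \<Longrightarrow> L_algebra B"
    and comparable: "B \<in> \<C> \<Longrightarrow> C \<in> \<C> \<Longrightarrow> B \<subseteq> C \<or> C \<subseteq> B"
begin

lemma common_member:
  assumes "B \<in> \<C>" "S \<in> \<Union>\<C>" "T \<in> \<Union>\<C>"
  obtains C where "C \<in> \<C>" "B \<subseteq> C" "S \<in> C" "T \<in> C"
proof -
  obtain B1 B2 where B12: "B1 \<in> \<C>" "S \<in> B1" "B2 \<in> \<C>" "T \<in> B2"
    using assms by blast
  have "B \<union> B1 \<in> \<C>" "B \<subseteq> B \<union> B1" "S \<in> B \<union> B1"
    using comparable[OF assms(1) B12(1)] assms(1) B12 by (auto simp: subset_Un_eq Un_absorb2)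
  moreover from this have "B \<union> B1 \<union> B2 \<in> \<C>"
    using comparable[OF _ B12(3)] B12(3) by (metis Un_absorb1 Un_absorb2)
  ultimately show thesis
    using that[of "B \<union> B1 \<union> B2"] B12 by blast
qed

lemma L_algebra_Union: "L_algebra (\<Union>\<C>)"
  unfolding L_algebra_def operator_algebra_def
proof (intro conjI ballI)
  obtain B where B: "B \<in> \<C>"
    using nonempty by blast
  then interpret B: L_alg B
    by (simp add: L_alg_def L_algebras)
  have "B \<subseteq> \<Union>\<C>"
    using B by blast
  show "transitive (\<Union>\<C>)"
    using B.L_algebra \<open>B \<subseteq> _\<close> by (auto simp: L_algebra_def intro: transitive_mono)
  show "\<exists>T\<in>\<Union>\<C>. T \<noteq> 0 \<and> finite_rank T"
    using B.L_algebra \<open>B \<subseteq> _\<close> unfolding L_algebra_def by blast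
  have sub: "subspace C" and comp: "S \<in> C \<Longrightarrow> T \<in> C \<Longrightarrow> S o\<^sub>L T \<in> C" if "C \<in> \<C>" for C S T
    using L_algebras[OF that] by (simp_all add: L_algebra_def operator_algebra_def)
  show "subspace (\<Union>\<C>)"
  proof (rule subspaceI)
    show "0 \<in> \<Union>\<C>"
      using B subspace_0[OF sub] by blast
    show "S + T \<in> \<Union>\<C>" if ST: "S \<in> \<Union>\<C>" "T \<in> \<Union>\<C>" for S T
    proof -
      obtain C where "C \<in> \<C>" "S \<in> C" "T \<in> C"
        by (rule common_member[OF B ST])
      then show ?thesis
        using subspace_add[OF sub] by blast
    qed
    show "c *\<^sub>R S \<in> \<Union>\<C>" if "S \<in> \<Union>\<C>" for c S
      using that subspace_scale[OF sub] by blast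
  qed
  show "S o\<^sub>L T \<in> \<Union>\<C>" if ST: "S \<in> \<Union>\<C>" "T \<in> \<Union>\<C>" for S T
  proof -
    obtain C where "C \<in> \<C>" "S \<in> C" "T \<in> C"
      by (rule common_member[OF B ST])
    then show ?thesis
      using comp by blast
  qed
qed

sublocale U: L_alg "\<Union>\<C>"
  by (simp add: L_alg_def L_algebra_Union)

lemma pair: "B \<in> \<C> \<Longrightarrow> C \<in> \<C> \<Longrightarrow> B \<subseteq> C \<Longrightarrow> L_alg_pair B C"
  by (simp add: L_alg_pair_def L_alg_def L_alg_pair_axioms_def L_algebras)

lemma pair_Union: "B \<in> \<C> \<Longrightarrow> L_alg_pair B (\<Union>\<C>)"
  by (auto simp: L_alg_pair_def L_alg_def L_alg_pair_axioms_def L_algebras L_algebra_Union)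

lemma F_Union: "U.F = (\<Union>B\<in>\<C>. finite_rank_part B)"
  by (auto simp: finite_rank_part_def)

text \<open>A fixed non-zero vector has \<open>V\<close> as its orbit for each member and for the union. This avoids an argument
  about spans of directed unions.\<close>

lemma V_Union: "U.V = (\<Union>B\<in>\<C>. finite_rank_space B)"
proof -
  obtain x where x: "x \<in> U.V" "x \<noteq> 0"
    by (rule U.exists_nonzero_V)
  have "U.V = (\<lambda>T. blinfun_apply T x) ` U.F"
    by (rule U.orbit[OF x(2), symmetric])
  also have "\<dots> = (\<Union>B\<in>\<C>. (\<lambda>T. blinfun_apply T x) ` finite_rank_part B)"
    by (auto simp: F_Union)
  also have "\<dots> = (\<Union>B\<in>\<C>. finite_rank_space B)"
    using L_alg.orbit[OF L_alg.intro[OF L_algebras] x(2)] by simp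
  finally show ?thesis .
qed

lemma common_member_V:
  assumes B: "B \<in> \<C>" and xy: "x \<in> U.V" "y \<in> U.V" and T: "T \<in> U.F"
  obtains C where "C \<in> \<C>" "B \<subseteq> C" "x \<in> finite_rank_space C" "y \<in> finite_rank_space C"
    "T \<in> finite_rank_part C"
proof -
  obtain w where w: "w \<in> U.V" "w \<noteq> 0"
    by (rule U.exists_nonzero_V)
  obtain R where R: "R \<in> U.F" "x = blinfun_apply R w"
    by (rule U.transport[OF w(2) xy(1)])
  obtain S where S: "S \<in> U.F" "y = blinfun_apply S w"
    by (rule U.transport[OF w(2) xy(2)])
  have un: "R \<in> \<Union>\<C>" "S \<in> \<Union>\<C>" "T \<in> \<Union>\<C>"
    using R S T by (simp_all add: finite_rank_part_def)
  obtain C1 where C1: "C1 \<in> \<C>" "B \<subseteq> C1" "R \<in> C1" "S \<in> C1"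
    by (rule common_member[OF B un(1,2)])
  obtain C where C: "C \<in> \<C>" "C1 \<subseteq> C" "T \<in> C"
    by (rule common_member[OF C1(1) un(3) un(3)])
  interpret C: L_alg C
    by (simp add: L_alg_def L_algebras C)
  have "R \<in> C.F" "S \<in> C.F" "T \<in> C.F" "B \<subseteq> C"
    using R S T C1 C by (auto simp: finite_rank_part_def)
  then show thesis
    by (intro that[OF C(1)]) (simp_all add: R(2) S(2) C.F_apply_V)
qed

text \<open>For each member \<open>C\<close> above \<open>B\<close> there is a unique extension \<open>G C\<close> of \<open>S0\<close> to the commutant of \<open>C\<close>. By
  uniqueness these extensions agree where they are both defined, and the glued map commutes with the
  finite rank operators since any two vectors and any such operator already occur in one member.\<close>

lemma commutant_extends:
  assumes B: "B \<in> \<C>" and type: "\<And>C. C \<in> \<C> \<Longrightarrow> of_type t C" and S0: "S0 \<in> commutant B"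
  obtains S where "S \<in> commutant (\<Union>\<C>)" "restrict_zero (finite_rank_space B) S = S0"
proof -
  interpret B: L_alg B
    by (simp add: L_alg_def L_algebras B)
  let ?up = "\<lambda>C. C \<in> \<C> \<and> B \<subseteq> C"
  have "\<exists>S\<in>commutant C. restrict_zero B.V S = S0" if C: "?up C" for C
  proof -
    interpret BC: L_alg_pair B C
      using pair B C by blast
    have "restrict_zero B.V ` commutant C = commutant B"
      using BC.restrict_onto type B C by blast
    with S0 have "S0 \<in> restrict_zero B.V ` commutant C"
      by simp
    then show ?thesis
      by (elim imageE) auto
  qed
  then have "\<forall>C. \<exists>S. ?up C \<longrightarrow> S \<in> commutant C \<and> restrict_zero B.V S = S0"
    by blast
  from choice[OF this] obtain G
    where G_all: "\<forall>C. ?up C \<longrightarrow> G C \<in> commutant C \<and> restrict_zero B.V (G C) = S0" ..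
  have G: "G C \<in> commutant C" and G0: "restrict_zero B.V (G C) = S0" if "?up C" for C
    using G_all[THEN spec[of _ C]] that by simp_all
  obtain x0 where x0: "x0 \<in> B.V" "x0 \<noteq> 0"
    by (rule B.exists_nonzero_V)
  have G_mono: "G C x = G C' x" if C: "?up C" and C': "?up C'" and "C \<subseteq> C'"
      and x: "x \<in> finite_rank_space C" for C C' x
  proof -
    interpret CC: L_alg_pair C C'
      using pair that by blast
    interpret BC: L_alg_pair B C
      using pair B C by blast
    \<comment> \<open>the restriction of \<open>G C'\<close> and \<open>G C\<close> are both in the commutant of \<open>C\<close> and agree at \<open>x0\<close>\<close>
    have x0': "x0 \<in> CC.A.V"
      using x0(1) BC.V_subset by blast
    have "G C' x0 = S0 x0" "G C x0 = S0 x0"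
      using fun_cong[OF G0[OF C'], of x0] fun_cong[OF G0[OF C], of x0] x0(1) by simp_all
    then have "restrict_zero CC.A.V (G C') x0 = G C x0"
      using x0' by simp
    then have "restrict_zero CC.A.V (G C') = G C"
      by (rule CC.A.commutant_eqI[OF CC.restrict_commutant[OF G[OF C']] G[OF C] x0' x0(2)])
    from fun_cong[OF this, of x] show ?thesis
      using x by simp
  qed
  have G_eq: "G C x = G C' x"
    if up: "?up C" "?up C'" and x: "x \<in> finite_rank_space C" "x \<in> finite_rank_space C'" for C C' x
  proof -
    consider "C \<subseteq> C'" | "C' \<subseteq> C"
      using comparable up by blast
    then show ?thesis
      by cases (simp_all add: G_mono[OF up _ x(1)] G_mono[OF up(2,1) _ x(2)])
  qed
  define S where
    "S x = (if x \<in> U.V then G (SOME C. ?up C \<and> x \<in> finite_rank_space C) x else 0)" for x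
  have S: "S x = G C x" if C: "?up C" and x: "x \<in> finite_rank_space C" for C x
  proof -
    define C' where "C' = (SOME C. ?up C \<and> x \<in> finite_rank_space C)"
    have C': "?up C'" "x \<in> finite_rank_space C'"
      using someI[of "\<lambda>C. ?up C \<and> x \<in> finite_rank_space C" C] C x
      unfolding C'_def by simp_all
    have "x \<in> U.V"
      using C x unfolding V_Union by blast
    then have "S x = G C' x"
      by (simp add: S_def C'_def)
    also have "\<dots> = G C x"
      by (rule G_eq[OF C'(1) C C'(2) x])
    finally show ?thesis .
  qed
  obtain T0 where T0: "T0 \<in> U.F"
    using subspace_0[OF U.subspace_F] by blast
  have "S \<in> commutant (\<Union>\<C>)"
  proof (rule U.commutantI)
    fix x assume x: "x \<in> U.V"
    have local: "S x \<in> U.V \<and> S (x + y) = S x + S y \<and> S (r *\<^sub>R x) = r *\<^sub>R S x \<and>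
        S (blinfun_apply T x) = blinfun_apply T (S x)" if y: "y \<in> U.V" and T: "T \<in> U.F" for y r T
    proof -
      obtain C where C: "C \<in> \<C>" "B \<subseteq> C" and xy: "x \<in> finite_rank_space C" "y \<in> finite_rank_space C"
        and TC: "T \<in> finite_rank_part C"
        by (rule common_member_V[OF B x y T])
      interpret C: L_alg C
        by (simp add: L_alg_def L_algebras C)
      have SC: "S z = G C z" if "z \<in> C.V" for z
        using S C that by blast
      note GC = C.commutantD[OF G[OF conjI[OF C]]]
      have "S x \<in> C.V"
        using GC(1) SC xy by simp
      then have "S x \<in> U.V"
        using C(1) by (auto simp: V_Union)
      then show ?thesis
        using xy TC
        by (simp add: SC GC(3,4,5) subspace_add[OF C.subspace_V] subspace_scale[OF C.subspace_V] C.F_apply_V)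
    qed
    show "S x \<in> U.V" "S (r *\<^sub>R x) = r *\<^sub>R S x" for r
      using local[OF x T0] by blast+
    show "S (x + y) = S x + S y" if "y \<in> U.V" for y
      using local[OF that T0] by blast
    show "S (blinfun_apply T x) = blinfun_apply T (S x)" if "T \<in> U.F" for T
      using local[OF x that] by blast
  qed (simp add: S_def)
  moreover have "restrict_zero B.V S = S0"
  proof
    fix x
    have up: "?up B"
      using B by simp
    show "restrict_zero B.V S x = S0 x"
    proof (cases "x \<in> B.V")
      case True
      with fun_cong[OF G0[OF up], of x] show ?thesis
        by (simp add: S[OF up])
    qed (simp add: B.commutantD(2)[OF S0])
  qed
  ultimately show thesis
    by (rule that)
qed

lemma of_type_Union:
  assumes type: "\<And>C. C \<in> \<C> \<Longrightarrow> of_type t C"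
  shows "of_type t (\<Union>\<C>)"
proof -
  obtain B where B: "B \<in> \<C>"
    using nonempty by blast
  interpret BU: L_alg_pair B "\<Union>\<C>"
    by (rule pair_Union[OF B])
  have "restrict_zero BU.A.V ` commutant (\<Union>\<C>) = commutant B"
  proof
    show "restrict_zero BU.A.V ` commutant (\<Union>\<C>) \<subseteq> commutant B"
      using BU.restrict_commutant by blast
    show "commutant B \<subseteq> restrict_zero BU.A.V ` commutant (\<Union>\<C>)"
    proof
      fix S0 assume "S0 \<in> commutant B"
      then obtain S where "S \<in> commutant (\<Union>\<C>)" "restrict_zero BU.A.V S = S0"
        using commutant_extends[OF B type] by metis
      then show "S0 \<in> restrict_zero BU.A.V ` commutant (\<Union>\<C>)"
        by blast
    qed
  qed
  then show ?thesis
    using BU.of_type_if_restrict_onto type[OF B] by blast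
qed

end

theorem corollary2p16:
  fixes A :: "('a::banach \<Rightarrow>\<^sub>L 'a) set"
  assumes "\<not> finite_dimensional (UNIV :: 'a set)"
    and "L_algebra A"
  shows "\<exists>t B. of_type t A \<and> L_algebra B \<and> of_type t B \<and> A \<subseteq> B \<and>
           (\<forall>C. L_algebra C \<and> of_type t C \<longrightarrow> \<not> B \<subset> C)"
proof -
  interpret A: L_alg A
    by (simp add: L_alg_def assms(2))
  obtain t where t: "of_type t A"
    by (rule A.commutant_type)
  let ?P = "{B. L_algebra B \<and> of_type t B \<and> A \<subseteq> B}"
  have "\<exists>M\<in>?P. \<forall>X\<in>?P. M \<subseteq> X \<longrightarrow> X = M"
  proof (rule subset_Zorn_nonempty)
    show "?P \<noteq> {}"
      using assms(2) t by blast
    fix \<C> assume \<C>: "\<C> \<noteq> {}" "subset.chain ?P \<C>"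
    then interpret C: L_alg_chain \<C>
      by unfold_locales (auto simp: subset_chain_def)
    have "of_type t (\<Union>\<C>)"
      by (rule C.of_type_Union) (use \<C>(2) in \<open>auto simp: subset_chain_def\<close>)
    moreover have "A \<subseteq> \<Union>\<C>"
      using \<C> unfolding subset_chain_def by blast
    ultimately show "\<Union>\<C> \<in> ?P"
      using C.L_algebra_Union by simp
  qed
  then obtain B where B: "L_algebra B" "of_type t B" "A \<subseteq> B" and max: "\<forall>X\<in>?P. B \<subseteq> X \<longrightarrow> X = B"
    by blast
  have "\<not> B \<subset> C" if "L_algebra C" "of_type t C" for C
    using that max B(3) by blast
  with t B show ?thesis
    by blast
qed

end
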